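(* For an irrotational flow $u=\nabla\Phi$ in the domain $\Omega_t$ bounded by $\partial\Omega_t=\{(1+h(t,x))x:x\in\mathbb S^1\}$, with boundary datum $\psi(t,x)=\Phi(t,(1+h(t,x))x)$ and with pressure normalized by $\partial_t\Phi+\frac12|\nabla\Phi|^2+p=\sigma_0$ in $\overline{\Omega_t}$, the free boundary problem $$\mathrm{div}\,u=0\ \text{ in }\Omega_t,\qquad \partial_tu+u\cdot\nabla u+\nabla p=0\ \text{ in }\Omega_t,\qquad p=\sigma_0H_{\Omega_t}\ \text{ on }\partial\Omega_t,\qquad V_t=\langle u,\nu_{\Omega_t}\rangle\ \text{ on }\partial\Omega_t$$ is equivalent to the following system for $h,\psi$ on $\mathbb S^1$: $$\partial_th=\frac{\sqrt{(1+h)^2+|\nabla_{\mathbb S^1}h|^2}}{1+h}\,G(h)\psi,$$ $$\partial_t\psi=\frac12\Big(G(h)\psi+\frac{\langle\nabla_{\mathbb S^1}\psi,\nabla_{\mathbb S^1}h\rangle}{(1+h)\sqrt{(1+h)^2+|\nabla_{\mathbb S^1}h|^2}}\Big)^2-\frac{|\nabla_{\mathbb S^1}\psi|^2}{2(1+h)^2}-\sigma_0(H(h)-1).$$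
   Context: $\sigma_0$ is the capillarity coefficient. All functions are assumed sufficiently smooth. $h(t,\cdot):\mathbb S^1\to(-1,+\infty)$ with $\mathbb S^1$ the unit circle in $\mathbb R^2$; $\Omega_t\subset\mathbb R^2$ is the bounded star-shaped domain with boundary $\partial\Omega_t=\gamma_t(\mathbb S^1)$, $\gamma_t(x)=(1+h(t,x))x$. $\nu_{\Omega_t}$ is the outward unit normal to $\partial\Omega_t$. $V_t(\gamma_t(x)):=\langle\partial_t\gamma_t(x),\nu_{\Omega_t}(\gamma_t(x))\rangle$ is the normal boundary velocity. $H_{\Omega_t}$ is the curvature of $\partial\Omega_t$ (sign such that it equals $1$ for the unit disk), and $H(h):=H_{\Omega_t}\circ\gamma_t$. $\nabla_{\mathbb S^1}$ is the tangential gradient on $\mathbb S^1$, with values in $\mathbb R^2$. The velocity field $u$ is assumed irrotational; the velocity potential $\Phi(t,\cdot)$ is the solution of $\Delta\Phi=0$ in $\Omega_t$, $\Phi(t,\gamma_t(x))=\psi(t,x)$ for $x\in\mathbb S^1$, and $u=\nabla\Phi$. The Dirichlet–Neumann operator is $G(h)\psi:=\langle\nabla\Phi\circ\gamma_t,\nu_{\Omega_t}\circ\gamma_t\rangle$ on $\mathbb S^1$. The free function of time in the Bernoulli identity $\partial_t\Phi+\frac12|\nabla\Phi|^2+p=c(t)$ is chosen as $c(t)=\sigma_0$. *)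

theory Defs
  imports "HOL-Analysis.Analysis"
begin

(* C^k on an open set, via iterated directional derivatives; on a finite-dimensional
   domain this is the usual notion. *)
primrec Ck_on :: "nat \<Rightarrow> 'a::real_normed_vector set \<Rightarrow> ('a \<Rightarrow> 'b::real_normed_vector) \<Rightarrow> bool" where
  "Ck_on 0 S f \<longleftrightarrow> continuous_on S f"
| "Ck_on (Suc k) S f \<longleftrightarrow> (\<forall>x\<in>S. f differentiable (at x)) \<and>
     (\<forall>v. Ck_on k S (\<lambda>x. frechet_derivative f (at x) v))"

definition grad :: "('a::real_inner \<Rightarrow> real) \<Rightarrow> 'a \<Rightarrow> 'a" where
  "grad f x = (THE D. GDERIV f x :> D)"

definition divergence :: "('a::euclidean_space \<Rightarrow> 'a) \<Rightarrow> 'a \<Rightarrow> real" where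
  "divergence u x = (\<Sum>b\<in>Basis. frechet_derivative u (at x) b \<bullet> b)"

definition laplacian :: "('a::euclidean_space \<Rightarrow> real) \<Rightarrow> 'a \<Rightarrow> real" where
  "laplacian f = divergence (grad f)"

(* The unit outward vector orthogonal to the frontier of S at y: secants of the
   frontier through y become orthogonal to n, and n points out of S. *)
definition outward_unit_normal :: "'a::real_inner set \<Rightarrow> 'a \<Rightarrow> 'a" where
  "outward_unit_normal S y = (THE n. norm n = 1 \<and>
     ((\<lambda>z. n \<bullet> (z - y) / norm (z - y)) \<longlongrightarrow> 0) (at y within frontier S) \<and>
     (\<forall>\<^sub>F s in at_right 0. y + s *\<^sub>R n \<notin> closure S))"

(* For a plane domain the shape operator (the differential of the outward normal along
   the boundary curve) is multiplication by the curvature. The unit disk has normal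
   y \<mapsto> y on its boundary, hence curvature 1. *)
definition curvature :: "(real^2) set \<Rightarrow> real^2 \<Rightarrow> real" where
  "curvature S y = (THE \<kappa>. (outward_unit_normal S has_derivative (\<lambda>v. \<kappa> *\<^sub>R v))
                              (at y within frontier S))"

abbreviation S1 :: "(real^2) set" where
  "S1 \<equiv> sphere 0 1"

definition circ :: "real \<Rightarrow> real^2" where
  "circ \<theta> = vector [cos \<theta>, sin \<theta>]"

definition rot90 :: "real^2 \<Rightarrow> real^2" where
  "rot90 x = vector [- (x $ 2), x $ 1]"

(* For x in S1, rot90 x spans the tangent line at x, and
   s \<mapsto> cos s x + sin s rot90 x is the unit-speed curve in S1 through x. *)
definition tangential_grad :: "(real^2 \<Rightarrow> real) \<Rightarrow> real^2 \<Rightarrow> real^2" where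
  "tangential_grad f x = deriv (\<lambda>s. f (cos s *\<^sub>R x + sin s *\<^sub>R rot90 x)) 0 *\<^sub>R rot90 x"

definition bdry_param :: "(real^2 \<Rightarrow> real) \<Rightarrow> real^2 \<Rightarrow> real^2" where
  "bdry_param h x = (1 + h x) *\<^sub>R x"

(* For continuous h > -1 this is the bounded domain, star-shaped about 0, with frontier
   bdry_param h ` S1. *)
definition star_domain :: "(real^2 \<Rightarrow> real) \<Rightarrow> (real^2) set" where
  "star_domain h = {r *\<^sub>R bdry_param h x | r x. 0 \<le> r \<and> r < 1 \<and> x \<in> S1}"

definition dirichlet_solution :: "(real^2 \<Rightarrow> real) \<Rightarrow> (real^2 \<Rightarrow> real) \<Rightarrow> (real^2 \<Rightarrow> real) \<Rightarrow> bool" where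
  "dirichlet_solution h \<psi> \<Phi> \<longleftrightarrow>
     Ck_on 2 (star_domain h) \<Phi> \<and> continuous_on (closure (star_domain h)) \<Phi> \<and>
     (\<forall>y\<in>star_domain h. laplacian \<Phi> y = 0) \<and>
     (\<forall>x\<in>S1. \<Phi> (bdry_param h x) = \<psi> x)"

(* Two solutions agree on the closed domain by the maximum principle, so the choice only
   concerns irrelevant values outside of it. *)
definition harmonic_extension :: "(real^2 \<Rightarrow> real) \<Rightarrow> (real^2 \<Rightarrow> real) \<Rightarrow> real^2 \<Rightarrow> real" where
  "harmonic_extension h \<psi> = (SOME \<Phi>. dirichlet_solution h \<psi> \<Phi>)"

(* The gradient on the boundary is the limit of the gradient from inside the domain. *)
definition dirichlet_neumann :: "(real^2 \<Rightarrow> real) \<Rightarrow> (real^2 \<Rightarrow> real) \<Rightarrow> real^2 \<Rightarrow> real" where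
  "dirichlet_neumann h \<psi> x =
     Lim (at (bdry_param h x) within star_domain h) (grad (harmonic_extension h \<psi>))
       \<bullet> outward_unit_normal (star_domain h) (bdry_param h x)"

definition bdry_curvature :: "(real^2 \<Rightarrow> real) \<Rightarrow> real^2 \<Rightarrow> real" where
  "bdry_curvature h x = curvature (star_domain h) (bdry_param h x)"

definition normal_velocity :: "(real \<Rightarrow> real^2 \<Rightarrow> real) \<Rightarrow> real \<Rightarrow> real^2 \<Rightarrow> real" where
  "normal_velocity h t x =
     vector_derivative (\<lambda>s. bdry_param (h s) x) (at t)
       \<bullet> outward_unit_normal (star_domain (h t)) (bdry_param (h t) x)"

definition free_boundary_problem ::
  "real \<Rightarrow> real set \<Rightarrow> (real \<Rightarrow> real^2 \<Rightarrow> real) \<Rightarrow> (real \<Rightarrow> real^2 \<Rightarrow> real^2) \<Rightarrow> (real \<Rightarrow> real^2 \<Rightarrow> real) \<Rightarrow> bool" where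
  "free_boundary_problem \<sigma>\<^sub>0 I h u p \<longleftrightarrow>
     (\<forall>t\<in>I.
        (\<forall>y\<in>star_domain (h t). divergence (u t) y = 0) \<and>
        (\<forall>y\<in>star_domain (h t).
           vector_derivative (\<lambda>s. u s y) (at t)
             + frechet_derivative (u t) (at y) (u t y) + grad (p t) y = 0) \<and>
        (\<forall>y\<in>frontier (star_domain (h t)). p t y = \<sigma>\<^sub>0 * curvature (star_domain (h t)) y) \<and>
        (\<forall>x\<in>S1. normal_velocity h t x =
           u t (bdry_param (h t) x) \<bullet> outward_unit_normal (star_domain (h t)) (bdry_param (h t) x)))"

definition boundary_system ::
  "real \<Rightarrow> real set \<Rightarrow> (real \<Rightarrow> real^2 \<Rightarrow> real) \<Rightarrow> (real \<Rightarrow> real^2 \<Rightarrow> real) \<Rightarrow> bool" where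
  "boundary_system \<sigma>\<^sub>0 I h \<psi> \<longleftrightarrow>
     (\<forall>t\<in>I. \<forall>x\<in>S1.
        deriv (\<lambda>s. h s x) t =
          sqrt ((1 + h t x)^2 + (norm (tangential_grad (h t) x))^2) / (1 + h t x)
            * dirichlet_neumann (h t) (\<psi> t) x \<and>
        deriv (\<lambda>s. \<psi> s x) t =
          1/2 * (dirichlet_neumann (h t) (\<psi> t) x
                 + tangential_grad (\<psi> t) x \<bullet> tangential_grad (h t) x
                   / ((1 + h t x) * sqrt ((1 + h t x)^2 + (norm (tangential_grad (h t) x))^2)))^2
          - (norm (tangential_grad (\<psi> t) x))^2 / (2 * (1 + h t x)^2)
          - \<sigma>\<^sub>0 * (bdry_curvature (h t) x - 1))"

end

(* Smoothness of the potential makes the Euler equation a consequence of the Bernoulli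
   identity: differentiate it in space and use the symmetry of the second derivatives of
   the potential in space-time. Since div (grad) is the Laplacian, div u = 0 says that the
   potential solves the Dirichlet problem, and by the maximum principle the
   Dirichlet-Neumann operator then is the normal derivative of that potential. What is left
   are the two boundary conditions. In the frame (x, rot90 x), with r = 1 + h, g the angular
   derivative of h and J = sqrt(r^2 + g^2), the normal is (r x - g rot90 x) / J. With
   grad Phi = a x + b rot90 x, the chain rule gives psi_theta = a g + b r and
   psi_t = Phi_t + a h_t, so both conditions are pointwise algebra in a, b, r, g. The
   curvature enters only as the same unspecified number on both sides. *)

theory Submission
  imports Defs
begin

section \<open>Calculus of \<open>C\<^sup>k\<close> functions\<close>

text \<open>Two features of the setting shape the proof. The normal is picked by \<open>THE\<close>
  from secants of the frontier, so it has to be computed: near a boundary point the closed domain is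
  a sublevel set of a differentiable function whose gradient is a positive multiple of the normal,
  and the boundary curve, having nonzero tangent, leaves only two candidate directions.
  Differentiability of \<open>h\<close> is assumed only along \<open>circ\<close>, hence that
  function goes through a local polar angle; the topology of the domain needs mere continuity and
  goes through a gauge.

  Second, \<open>u\<close> and \<open>p\<close> are tied to the potential only on the moving closed
  domain. Space derivatives at an interior point are safe, but the time derivative needs the point
  to stay in the domain for nearby times. The potential itself is C^2 on an open space-time set
  \<open>U\<close> containing these closed domains, so its gradient is continuous up to the boundary
  and equals there the inner limit in \<open>dirichlet_neumann\<close>.

  The two dynamic conditions are matched only after the kinematic one has supplied the time
  derivative of \<open>h\<close>.\<close>

text \<open>Openness of \<open>S\<close> makes derivatives at its points depend on values in
  \<open>S\<close> only. The inductions below use this to trade a \<open>frechet_derivative\<close>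
  for an explicit formula.\<close>

lemma Ck_on_cong:
  assumes "open S" "\<And>x. x \<in> S \<Longrightarrow> f x = g x" "Ck_on k S f"
  shows "Ck_on k S g"
  using assms(2,3)
proof (induction k arbitrary: f g)
  case 0
  then show ?case by (simp cong: continuous_on_cong)
next
  case (Suc k)
  have d: "(g has_derivative frechet_derivative f (at x)) (at x)" if "x \<in> S" for x
  proof -
    have "(f has_derivative frechet_derivative f (at x)) (at x)"
      using Suc.prems(2) that frechet_derivative_works by auto
    then show ?thesis
      using has_derivative_transform_within_open[OF _ \<open>open S\<close> that] Suc.prems(1) by blast
  qed
  then have e: "frechet_derivative f (at x) = frechet_derivative g (at x)" if "x \<in> S" for x
    using that frechet_derivative_at by blast
  have "Ck_on k S (\<lambda>x. frechet_derivative g (at x) v)" for v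
    by (rule Suc.IH[of "\<lambda>x. frechet_derivative f (at x) v"]) (use Suc.prems(2) e in auto)
  with d show ?case by (auto simp: differentiable_def)
qed

lemma Ck_on_subset:
  assumes "Ck_on k S f" "T \<subseteq> S"
  shows "Ck_on k T f"
  using assms(1)
proof (induction k arbitrary: f)
  case 0
  then show ?case using assms(2) continuous_on_subset by auto
qed (use assms(2) in auto)

lemma Ck_on_Suc_continuous:
  assumes "Ck_on (Suc k) S f"
  shows "continuous_on S f"
  using assms by (auto intro!: continuous_at_imp_continuous_on differentiable_imp_continuous_within)

lemma Ck_on_Suc_has_derivative:
  assumes "Ck_on (Suc k) S f" "x \<in> S"
  shows "(f has_derivative frechet_derivative f (at x)) (at x)"
proof -
  have "f differentiable at x" using assms by simp
  then show ?thesis using frechet_derivative_works by blast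
qed

lemma Ck_on_2_has_derivative:
  assumes "Ck_on 2 S f" "x \<in> S"
  shows "(f has_derivative frechet_derivative f (at x)) (at x)"
    and "((\<lambda>y. frechet_derivative f (at y) v) has_derivative
           frechet_derivative (\<lambda>y. frechet_derivative f (at y) v) (at x)) (at x)"
proof -
  have "f differentiable at x" "(\<lambda>y. frechet_derivative f (at y) v) differentiable at x"
    using assms by (auto simp: numeral_2_eq_2)
  then show "(f has_derivative frechet_derivative f (at x)) (at x)"
    "((\<lambda>y. frechet_derivative f (at y) v) has_derivative
       frechet_derivative (\<lambda>y. frechet_derivative f (at y) v) (at x)) (at x)"
    using frechet_derivative_works by blast+
qed

section \<open>Restriction to slices and lines\<close>

lemma has_derivative_slice:
  assumes "(F has_derivative F') (at (t, y))"
  shows "((\<lambda>y. F (t, y)) has_derivative (\<lambda>v. F' (0, v))) (at y)"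
    and "((\<lambda>s. F (s, y)) has_derivative (\<lambda>s. F' (s, 0))) (at t)"
  by (rule has_derivative_compose[of "\<lambda>y. (t, y)" _ _ _ F],
      auto intro!: derivative_eq_intros simp: assms,
      rule has_derivative_compose[of "\<lambda>s. (s, y)" _ _ _ F],
      auto intro!: derivative_eq_intros simp: assms)

lemma open_slice:
  assumes "open U"
  shows "open {y. (t, y) \<in> U}"
proof -
  have "continuous_on UNIV (\<lambda>y. (t, y))" by (intro continuous_intros)
  from open_vimage[OF assms this] show ?thesis by (simp add: vimage_def)
qed

text \<open>A derivative of the slice in direction \<open>v\<close> is the derivative of
  \<open>F\<close> in direction \<open>(0, v)\<close>, again a slice of a function one degree less
  smooth.\<close>

lemma Ck_on_slice:
  assumes "open U" "Ck_on k U F"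
  shows "Ck_on k {y. (t, y) \<in> U} (\<lambda>y. F (t, y))"
  using assms(2)
proof (induction k arbitrary: F)
  case 0
  then show ?case
    by (auto intro!: continuous_on_compose2[of U F _ "\<lambda>y. (t, y)"] continuous_intros)
next
  case (Suc k)
  have d: "((\<lambda>y. F (t, y)) has_derivative (\<lambda>v. frechet_derivative F (at (t, y)) (0, v))) (at y)"
    if "(t, y) \<in> U" for y
    by (rule has_derivative_slice) (use that Suc.prems frechet_derivative_works in auto)
  have "Ck_on k {y. (t, y) \<in> U} (\<lambda>x. frechet_derivative (\<lambda>y. F (t, y)) (at x) v)" for v
    by (rule Ck_on_cong[OF open_slice[OF assms(1)] _ Suc.IH[of "\<lambda>p. frechet_derivative F (at p) (0, v)"]])
      (use Suc.prems fun_cong[OF frechet_derivative_at[OF d]] in auto)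
  with d show ?case by (auto simp: differentiable_def)
qed

lemma has_derivative_line:
  fixes g :: "'a::real_normed_vector \<Rightarrow> real"
  assumes "(g has_derivative g') (at (z + s *\<^sub>R e))"
  shows "((\<lambda>s. g (z + s *\<^sub>R e)) has_real_derivative g' e) (at s)"
proof -
  have "((\<lambda>s. g (z + s *\<^sub>R e)) has_derivative (\<lambda>h. g' (h *\<^sub>R e))) (at s)"
    by (rule has_derivative_compose[of "\<lambda>s. z + s *\<^sub>R e" _ _ _ g])
      (auto intro!: derivative_eq_intros simp: assms)
  moreover have "(\<lambda>h. g' (h *\<^sub>R e)) = (*) (g' e)"
    using has_derivative_linear[OF assms] by (auto simp: linear_cmul mult.commute)
  ultimately show ?thesis by (simp add: has_field_derivative_def)
qed

section \<open>Symmetry of second derivatives\<close>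

text \<open>The mean value theorem is applied twice: along \<open>v\<close> to the difference of
  \<open>f\<close> on two parallel edges, then along \<open>w\<close> to the resulting directional
  derivative. The intermediate points stay in the parallelogram, which lies in
  \<open>U\<close>.\<close>

lemma mean_value_square:
  fixes f :: "'a::real_normed_vector \<Rightarrow> real"
  assumes C2: "Ck_on 2 U f" and "r > 0"
    and sub: "\<And>a b. a \<in> {0..r} \<Longrightarrow> b \<in> {0..r} \<Longrightarrow> x + a *\<^sub>R v + b *\<^sub>R w \<in> U"
  obtains a b where "a \<in> {0..r}" "b \<in> {0..r}"
    "f (x + r *\<^sub>R v + r *\<^sub>R w) - f (x + r *\<^sub>R v) - f (x + r *\<^sub>R w) + f x =
       r\<^sup>2 * frechet_derivative (\<lambda>y. frechet_derivative f (at y) v) (at (x + a *\<^sub>R v + b *\<^sub>R w)) w"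
proof -
  let ?D = "\<lambda>y. frechet_derivative f (at y) v"
  let ?D2 = "\<lambda>y. frechet_derivative ?D (at y) w"
  note d1 = Ck_on_2_has_derivative(1)[OF C2] and d2 = Ck_on_2_has_derivative(2)[OF C2]
  have k: "((\<lambda>s. f (x + r *\<^sub>R w + s *\<^sub>R v) - f (x + s *\<^sub>R v)) has_real_derivative
      ?D (x + r *\<^sub>R w + s *\<^sub>R v) - ?D (x + s *\<^sub>R v)) (at s)" if "s \<in> {0..r}" for s
    using sub[of s r] sub[of s 0] that \<open>r > 0\<close>
    by (intro DERIV_diff has_derivative_line d1) (auto simp: algebra_simps)
  obtain a where a: "0 < a" "a < r" and
    ea: "(f (x + r *\<^sub>R w + r *\<^sub>R v) - f (x + r *\<^sub>R v)) - (f (x + r *\<^sub>R w) - f x) =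
       r * (?D (x + r *\<^sub>R w + a *\<^sub>R v) - ?D (x + a *\<^sub>R v))"
    using MVT2[OF \<open>r > 0\<close>, of "\<lambda>s. f (x + r *\<^sub>R w + s *\<^sub>R v) - f (x + s *\<^sub>R v)"
        "\<lambda>s. ?D (x + r *\<^sub>R w + s *\<^sub>R v) - ?D (x + s *\<^sub>R v)"] k by auto
  have k': "((\<lambda>s. ?D (x + a *\<^sub>R v + s *\<^sub>R w)) has_real_derivative ?D2 (x + a *\<^sub>R v + s *\<^sub>R w)) (at s)"
    if "s \<in> {0..r}" for s
    using sub[of a s] that a by (intro has_derivative_line d2) auto
  obtain b where b: "0 < b" "b < r" and
    eb: "?D (x + a *\<^sub>R v + r *\<^sub>R w) - ?D (x + a *\<^sub>R v) = r * ?D2 (x + a *\<^sub>R v + b *\<^sub>R w)"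
    using MVT2[OF \<open>r > 0\<close>, of "\<lambda>s. ?D (x + a *\<^sub>R v + s *\<^sub>R w)"
        "\<lambda>s. ?D2 (x + a *\<^sub>R v + s *\<^sub>R w)"] k' by auto
  show thesis
  proof (rule that[of a b])
    have swap: "x + r *\<^sub>R w + s *\<^sub>R v = x + s *\<^sub>R v + r *\<^sub>R w" for s
      by (simp add: algebra_simps)
    have "f (x + r *\<^sub>R v + r *\<^sub>R w) - f (x + r *\<^sub>R v) - f (x + r *\<^sub>R w) + f x =
        r * (?D (x + a *\<^sub>R v + r *\<^sub>R w) - ?D (x + a *\<^sub>R v))"
      using ea unfolding swap by linarith
    then show "f (x + r *\<^sub>R v + r *\<^sub>R w) - f (x + r *\<^sub>R v) - f (x + r *\<^sub>R w) + f x =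
        r\<^sup>2 * ?D2 (x + a *\<^sub>R v + b *\<^sub>R w)"
      unfolding eb by (simp add: power2_eq_square)
  qed (use a b in auto)
qed

lemma second_derivative_symmetric:
  fixes f :: "'a::real_normed_vector \<Rightarrow> real"
  assumes "open U" and C2: "Ck_on 2 U f" and "x \<in> U"
  shows "frechet_derivative (\<lambda>y. frechet_derivative f (at y) v) (at x) w =
         frechet_derivative (\<lambda>y. frechet_derivative f (at y) w) (at x) v"
proof -
  define A where "A v w y = frechet_derivative (\<lambda>y. frechet_derivative f (at y) v) (at y) w" for v w y
  have cont: "continuous_on U (A v w)" for v w
    using C2 by (simp add: numeral_2_eq_2 A_def[abs_def])
  \<comment> \<open>The second difference over a small parallelogram does not depend on the order of the
    directions, and is \<open>r\<^sup>2\<close> times a value of either mixed derivative nearby.\<close>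
  have "\<bar>A v w x - A w v x\<bar> < e" if "e > 0" for e
  proof -
    have near: "\<exists>d>0. \<forall>y. dist y x < d \<longrightarrow> \<bar>A v w y - A v w x\<bar> < e / 2" for v w
      using cont[of v w] \<open>open U\<close> \<open>x \<in> U\<close> \<open>e > 0\<close>
      by (metis continuous_on_eq_continuous_at continuous_at_eps_delta dist_real_def half_gt_zero)
    obtain d1 where d1: "d1 > 0" "\<And>y. dist y x < d1 \<Longrightarrow> \<bar>A v w y - A v w x\<bar> < e / 2"
      using near by blast
    obtain d2 where d2: "d2 > 0" "\<And>y. dist y x < d2 \<Longrightarrow> \<bar>A w v y - A w v x\<bar> < e / 2"
      using near by blast
    obtain d3 where d3: "d3 > 0" "\<And>y. dist y x < d3 \<Longrightarrow> y \<in> U"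
      using \<open>open U\<close> \<open>x \<in> U\<close> open_dist by metis
    define d where "d = min d1 (min d2 d3)"
    \<comment> \<open>This keeps the whole parallelogram within distance \<open>d / 2\<close> of
      \<open>x\<close>; the summand 1 avoids a zero denominator when both directions vanish.\<close>
    define r where "r = d / (2 * (norm v + norm w + 1))"
    have "d > 0" using d1 d2 d3 by (simp add: d_def)
    then have "r > 0" by (auto simp: r_def intro!: divide_pos_pos add_nonneg_pos)
    have small: "dist (x + a *\<^sub>R v + b *\<^sub>R w) x < d" if "a \<in> {0..r}" "b \<in> {0..r}" for a b
    proof -
      have "dist (x + a *\<^sub>R v + b *\<^sub>R w) x \<le> a * norm v + b * norm w"
        using that norm_triangle_ineq[of "a *\<^sub>R v" "b *\<^sub>R w"] by (simp add: dist_norm add.assoc)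
      also have "\<dots> \<le> r * norm v + r * norm w"
        using that by (intro add_mono mult_right_mono) auto
      also have "\<dots> \<le> r * (norm v + norm w + 1)"
        using \<open>r > 0\<close> by (simp add: algebra_simps)
      also have "\<dots> = d / 2"
      proof -
        have "norm v + norm w + 1 > 0" by (simp add: add_nonneg_pos)
        then show ?thesis unfolding r_def by (simp add: field_simps)
      qed
      also have "\<dots> < d" using \<open>d > 0\<close> by simp
      finally show ?thesis .
    qed
    have inU: "x + a *\<^sub>R v + b *\<^sub>R w \<in> U" if "a \<in> {0..r}" "b \<in> {0..r}" for a b
      using small[OF that] d3 by (simp add: d_def)
    obtain a b where ab: "a \<in> {0..r}" "b \<in> {0..r}"
      "f (x + r *\<^sub>R v + r *\<^sub>R w) - f (x + r *\<^sub>R v) - f (x + r *\<^sub>R w) + f x =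
         r\<^sup>2 * A v w (x + a *\<^sub>R v + b *\<^sub>R w)"
      unfolding A_def by (rule mean_value_square[OF C2 \<open>r > 0\<close> inU])
    have inU': "x + a *\<^sub>R w + b *\<^sub>R v \<in> U" if "a \<in> {0..r}" "b \<in> {0..r}" for a b
      using inU[OF that(2,1)] by (simp add: algebra_simps)
    obtain a' b' where ab': "a' \<in> {0..r}" "b' \<in> {0..r}"
      "f (x + r *\<^sub>R w + r *\<^sub>R v) - f (x + r *\<^sub>R w) - f (x + r *\<^sub>R v) + f x =
         r\<^sup>2 * A w v (x + a' *\<^sub>R w + b' *\<^sub>R v)"
      unfolding A_def by (rule mean_value_square[OF C2 \<open>r > 0\<close> inU'])
    have swap: "x + r *\<^sub>R w + r *\<^sub>R v = x + r *\<^sub>R v + r *\<^sub>R w"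
      by (simp add: algebra_simps)
    have "r\<^sup>2 * A v w (x + a *\<^sub>R v + b *\<^sub>R w) = r\<^sup>2 * A w v (x + a' *\<^sub>R w + b' *\<^sub>R v)"
      using ab(3) ab'(3) unfolding swap by linarith
    then have "A v w (x + a *\<^sub>R v + b *\<^sub>R w) = A w v (x + a' *\<^sub>R w + b' *\<^sub>R v)"
      using \<open>r > 0\<close> by simp
    moreover have "\<bar>A v w (x + a *\<^sub>R v + b *\<^sub>R w) - A v w x\<bar> < e / 2"
      using d1(2) small[OF ab(1,2)] by (simp add: d_def)
    moreover have "\<bar>A w v (x + a' *\<^sub>R w + b' *\<^sub>R v) - A w v x\<bar> < e / 2"
      using d2(2) small[OF ab'(2,1)] by (simp add: d_def algebra_simps)
    ultimately show ?thesis by linarith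
  qed
  \<comment> \<open>With the difference itself as \<open>e\<close>, a positive difference would be
    smaller than itself.\<close>
  from this[of "\<bar>A v w x - A w v x\<bar>"] have "A v w x = A w v x" by auto
  then show ?thesis by (simp add: A_def)
qed

section \<open>Gradient, divergence and Laplacian\<close>

lemma GDERIV_unique:
  assumes "GDERIV f x :> D" "GDERIV f x :> E"
  shows "D = E"
proof -
  have "(\<lambda>h. h \<bullet> D) = (\<lambda>h. h \<bullet> E)"
    by (rule has_derivative_unique) (use assms in \<open>simp_all only: gderiv_def\<close>)
  then have "\<forall>h. h \<bullet> D = h \<bullet> E" by (simp add: fun_eq_iff)
  then show ?thesis by (simp only: vector_eq_ldot)
qed

lemma grad_eq:
  assumes "GDERIV f x :> D"
  shows "grad f x = D"
proof -
  have "E = D" if "GDERIV f x :> E" for E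
    by (rule GDERIV_unique[OF that assms])
  with assms show ?thesis
    unfolding grad_def by (rule the_equality)
qed

lemma GDERIV_grad:
  fixes f :: "'a::euclidean_space \<Rightarrow> real"
  assumes "(f has_derivative f') (at x)"
  shows "GDERIV f x :> grad f x" and "grad f x = (\<Sum>b\<in>Basis. f' b *\<^sub>R b)"
proof -
  have "f' v = v \<bullet> (\<Sum>b\<in>Basis. f' b *\<^sub>R b)" for v
  proof -
    have "f' v = f' (\<Sum>b\<in>Basis. (v \<bullet> b) *\<^sub>R b)" by (simp add: euclidean_representation)
    also have "\<dots> = (\<Sum>b\<in>Basis. (v \<bullet> b) * f' b)"
      using has_derivative_linear[OF assms] by (simp add: linear_sum linear_cmul)
    finally show ?thesis by (simp add: inner_sum_right mult.commute)
  qed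
  then have "GDERIV f x :> (\<Sum>b\<in>Basis. f' b *\<^sub>R b)"
    using assms unfolding gderiv_def by (metis (no_types, lifting) ext)
  then show "GDERIV f x :> grad f x" "grad f x = (\<Sum>b\<in>Basis. f' b *\<^sub>R b)"
    using grad_eq by metis+
qed

lemma grad_inner:
  fixes f :: "'a::euclidean_space \<Rightarrow> real"
  assumes "(f has_derivative f') (at x)"
  shows "grad f x \<bullet> v = f' v"
  using GDERIV_grad(1)[OF assms] has_derivative_unique[OF assms]
  unfolding gderiv_def by (metis inner_commute)

text \<open>No differentiability is assumed: the predicates under \<open>THE\<close> coincide, hence
  so do the chosen values. The same argument serves \<open>divergence_cong\<close>.\<close>

lemma grad_cong:
  assumes "open S" "x \<in> S" "\<And>y. y \<in> S \<Longrightarrow> f y = g y"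
  shows "grad f x = grad g x"
proof -
  have "GDERIV f x :> D \<longleftrightarrow> GDERIV g x :> D" for D
    unfolding gderiv_def
    using has_derivative_transform_within_open[OF _ assms(1,2)] assms(3) by metis
  then show ?thesis by (simp add: grad_def)
qed

lemma divergence_cong:
  assumes "open S" "x \<in> S" "\<And>y. y \<in> S \<Longrightarrow> f y = g y"
  shows "divergence f x = divergence g x"
proof -
  have "(f has_derivative D) (at x) \<longleftrightarrow> (g has_derivative D) (at x)" for D
    using has_derivative_transform_within_open[OF _ assms(1,2)] assms(3) by metis
  then show ?thesis by (simp add: divergence_def frechet_derivative_def)
qed

text \<open>This turns the nested \<open>divergence\<close> and \<open>grad\<close> into iterated
  directional derivatives, the form in which \<open>Ck_on\<close> is stated and in which a maximum
  can be tested one coordinate at a time.\<close>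

lemma laplacian_sum:
  fixes f :: "'a::euclidean_space \<Rightarrow> real"
  assumes "open S" "Ck_on 2 S f" "x \<in> S"
  shows "laplacian f x =
    (\<Sum>b\<in>Basis. frechet_derivative (\<lambda>y. frechet_derivative f (at y) b) (at x) b)"
proof -
  let ?D = "\<lambda>b y. frechet_derivative f (at y) b"
  have "laplacian f x = divergence (\<lambda>y. \<Sum>b\<in>Basis. ?D b y *\<^sub>R b) x"
    unfolding laplacian_def
    by (rule divergence_cong[OF assms(1,3)], rule GDERIV_grad(2))
      (rule Ck_on_2_has_derivative(1)[OF assms(2)])
  also have "\<dots> = (\<Sum>b\<in>Basis. frechet_derivative (?D b) (at x) b)"
  proof -
    have "((\<lambda>y. \<Sum>b\<in>Basis. ?D b y *\<^sub>R b) has_derivative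
        (\<lambda>v. \<Sum>b\<in>Basis. frechet_derivative (?D b) (at x) v *\<^sub>R b)) (at x)"
      by (intro has_derivative_sum has_derivative_scaleR_left Ck_on_2_has_derivative(2)[OF assms(2,3)])
    from frechet_derivative_at[OF this, symmetric] show ?thesis
      by (auto simp: divergence_def inner_sum_left inner_Basis intro!: sum.cong)
        (simp add: if_distrib cong: if_cong)
  qed
  finally show ?thesis .
qed

lemma Ck_on_diff:
  assumes "open S" "Ck_on k S f" "Ck_on k S g"
  shows "Ck_on k S (\<lambda>x. f x - g x)"
  using assms(2,3)
proof (induction k arbitrary: f g)
  case 0
  then show ?case by (auto intro!: continuous_intros)
next
  case (Suc k)
  have d: "((\<lambda>x. f x - g x) has_derivative
      (\<lambda>v. frechet_derivative f (at x) v - frechet_derivative g (at x) v)) (at x)" if "x \<in> S" for x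
    by (intro has_derivative_diff Ck_on_Suc_has_derivative[OF Suc.prems(1) that]
        Ck_on_Suc_has_derivative[OF Suc.prems(2) that])
  have "Ck_on k S (\<lambda>x. frechet_derivative (\<lambda>x. f x - g x) (at x) v)" for v
    by (rule Ck_on_cong[OF assms(1) _ Suc.IH[of "\<lambda>x. frechet_derivative f (at x) v"
            "\<lambda>x. frechet_derivative g (at x) v"]])
      (use Suc.prems fun_cong[OF frechet_derivative_at[OF d]] in auto)
  with d show ?case by (auto simp: differentiable_def)
qed

lemma laplacian_diff:
  fixes f g :: "'a::euclidean_space \<Rightarrow> real"
  assumes "open S" "Ck_on 2 S f" "Ck_on 2 S g" "x \<in> S"
  shows "laplacian (\<lambda>x. f x - g x) x = laplacian f x - laplacian g x"
proof -
  let ?D = "\<lambda>f y v. frechet_derivative f (at y) v"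
  let ?k = "\<lambda>x. f x - g x"
  note df = Ck_on_2_has_derivative[OF assms(2)] and dg = Ck_on_2_has_derivative[OF assms(3)]
  have d1: "?D ?k y b = ?D f y b - ?D g y b" if "y \<in> S" for y b
    using frechet_derivative_at[OF has_derivative_diff[OF df(1)[OF that] dg(1)[OF that]]]
    by (metis (no_types, lifting))
  have d2: "?D (\<lambda>y. ?D ?k y b) x b = ?D (\<lambda>y. ?D f y b) x b - ?D (\<lambda>y. ?D g y b) x b" for b
  proof -
    have "((\<lambda>y. ?D ?k y b) has_derivative (\<lambda>v. ?D (\<lambda>y. ?D f y b) x v - ?D (\<lambda>y. ?D g y b) x v)) (at x)"
      by (rule has_derivative_transform_within_open
          [OF has_derivative_diff[OF df(2) dg(2)] assms(1)]) (use assms d1 in auto)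
    from fun_cong[OF frechet_derivative_at[OF this]] show ?thesis by simp
  qed
  show ?thesis
    unfolding laplacian_sum[OF assms(1) Ck_on_diff[OF assms(1-3)] assms(4)]
      laplacian_sum[OF assms(1,2,4)] laplacian_sum[OF assms(1,3,4)]
    by (simp add: d2 sum_subtractf)
qed

section \<open>The maximum principle\<close>

text \<open>The first derivative vanishes at 0. Were \<open>c\<close> positive, it would be positive
  just to the right of 0, and the mean value theorem would push \<open>k\<close> above its
  maximum.\<close>

lemma second_derivative_nonpos_at_local_max:
  fixes k :: "real \<Rightarrow> real"
  assumes "d > 0"
    and k: "\<And>s. \<bar>s\<bar> < d \<Longrightarrow> (k has_real_derivative k1 s) (at s)"
    and k1: "(k1 has_real_derivative c) (at 0)"
    and max: "\<And>s. \<bar>s\<bar> < d \<Longrightarrow> k s \<le> k 0"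
  shows "c \<le> 0"
proof (rule ccontr)
  assume "\<not> c \<le> 0"
  have "k1 0 = 0"
    by (rule DERIV_local_max[OF k \<open>d > 0\<close>]) (use \<open>d > 0\<close> max in auto)
  obtain e where "e > 0" and e: "\<And>s. 0 < s \<Longrightarrow> s < e \<Longrightarrow> k1 0 < k1 (0 + s)"
    using DERIV_pos_inc_right[OF k1] \<open>\<not> c \<le> 0\<close> by auto
  define s where "s = min d e / 2"
  have s: "0 < s" "s < d" "s < e" using \<open>d > 0\<close> \<open>e > 0\<close> by (auto simp: s_def)
  have pos: "k1 z > 0" if "0 < z" "z < s" for z
    using e[of z] that s \<open>k1 0 = 0\<close> by simp
  obtain z where "0 < z" "z < s" "k s - k 0 = (s - 0) * k1 z"
    using MVT2[of 0 s k k1] k s by force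
  moreover from this have "(s - 0) * k1 z > 0" using pos s(1) by simp
  ultimately have "k s > k 0" by linarith
  then show False using max[of s] s by simp
qed

text \<open>Adding a small multiple of the squared norm makes the Laplacian strictly positive, which
  excludes an interior maximum; the multiple is small enough that the maximum cannot lie on the
  frontier either.\<close>

lemma weak_maximum_principle:
  fixes f :: "'a::euclidean_space \<Rightarrow> real"
  assumes "open S" "bounded S" and C2: "Ck_on 2 S f" and cont: "continuous_on (closure S) f"
    and lap: "\<And>x. x \<in> S \<Longrightarrow> laplacian f x \<ge> 0"
    and fr: "\<And>x. x \<in> frontier S \<Longrightarrow> f x \<le> 0"
    and x: "x \<in> closure S"
  shows "f x \<le> 0"
proof (rule ccontr)
  assume neg: "\<not> f x \<le> 0"
  obtain R where R: "\<And>y. y \<in> closure S \<Longrightarrow> norm y \<le> R"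
    using \<open>bounded S\<close> bounded_closure bounded_iff by metis
  \<comment> \<open>Then \<open>e * (R\<^sup>2 + 1)\<close> is half of \<open>f x\<close>. On the
    frontier \<open>w\<close> is at most \<open>e * R\<^sup>2\<close>, which is less than
    \<open>f x\<close> and so less than the maximum of \<open>w\<close>.\<close>
  define e where "e = f x / (2 * (R\<^sup>2 + 1))"
  have R1: "R\<^sup>2 + 1 > 0" by (simp add: add_nonneg_pos)
  then have "e > 0" using neg by (simp add: e_def)
  define w where "w y = f y + e * (y \<bullet> y)" for y
  have "continuous_on (closure S) w"
    unfolding w_def by (intro continuous_intros cont)
  moreover have "compact (closure S)" using \<open>bounded S\<close> by (simp add: compact_closure)
  ultimately have "\<exists>m\<in>closure S. \<forall>y\<in>closure S. w y \<le> w m"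
    using x by (intro continuous_attains_sup) auto
  then obtain m where m: "m \<in> closure S" "\<And>y. y \<in> closure S \<Longrightarrow> w y \<le> w m" by blast
  have "m \<in> S"
  proof (rule ccontr)
    assume "m \<notin> S"
    then have "f m \<le> 0" using m(1) fr \<open>open S\<close> by (simp add: frontier_def interior_open)
    moreover have "e * (m \<bullet> m) \<le> e * R\<^sup>2"
      using R[OF m(1)] \<open>e > 0\<close>
      by (intro mult_left_mono) (auto simp: power2_norm_eq_inner[symmetric] intro: power_mono)
    moreover have "e * R\<^sup>2 < f x"
    proof -
      have "f x = 2 * (e * (R\<^sup>2 + 1))" using R1 by (simp add: e_def field_simps)
      then show ?thesis using \<open>e > 0\<close> zero_le_power2[of R] by (simp add: algebra_simps add_pos_nonneg)
    qed
    moreover have "f x \<le> w x" using \<open>e > 0\<close> by (simp add: w_def)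
    ultimately show False using m(2)[OF x] by (simp add: w_def)
  qed
  obtain d where "d > 0" and d: "\<And>y. dist y m < d \<Longrightarrow> y \<in> S"
    using \<open>open S\<close> \<open>m \<in> S\<close> open_dist by metis
  let ?D = "\<lambda>b y. frechet_derivative f (at y) b"
  \<comment> \<open>Along a unit coordinate vector the perturbation has second derivative
    \<open>2 * e\<close>, so the second derivative of \<open>f\<close> at the maximum point
    \<open>m\<close> of \<open>w\<close> is at most \<open>- 2 * e\<close>.\<close>
  have "frechet_derivative (?D b) (at m) b \<le> - 2 * e" if "b \<in> Basis" for b
  proof -
    have inS: "m + s *\<^sub>R b \<in> S" if "\<bar>s\<bar> < d" for s
      using d that \<open>b \<in> Basis\<close> by (simp add: dist_norm)
    have "frechet_derivative (?D b) (at m) b + 2 * e \<le> 0"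
    proof (rule second_derivative_nonpos_at_local_max[OF \<open>d > 0\<close>])
      show "((\<lambda>s. w (m + s *\<^sub>R b)) has_real_derivative
          ?D b (m + s *\<^sub>R b) + e * (2 * (m \<bullet> b) + 2 * s)) (at s)" if "\<bar>s\<bar> < d" for s
      proof -
        have "(m + s *\<^sub>R b) \<bullet> (m + s *\<^sub>R b) = m \<bullet> m + 2 * s * (m \<bullet> b) + s\<^sup>2" for s
          using \<open>b \<in> Basis\<close> by (simp add: algebra_simps inner_commute power2_eq_square)
        then show ?thesis unfolding w_def
          by (auto intro!: derivative_eq_intros
              has_derivative_line[OF Ck_on_2_has_derivative(1)[OF C2 inS[OF that]]])
      qed
      have "((\<lambda>s. ?D b (m + s *\<^sub>R b)) has_real_derivative frechet_derivative (?D b) (at m) b) (at 0)"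
        by (rule has_derivative_line) (use Ck_on_2_has_derivative(2)[OF C2 \<open>m \<in> S\<close>] in simp)
      then show "((\<lambda>s. ?D b (m + s *\<^sub>R b) + e * (2 * (m \<bullet> b) + 2 * s)) has_real_derivative
          frechet_derivative (?D b) (at m) b + 2 * e) (at 0)"
        by (auto intro!: derivative_eq_intros)
      show "w (m + s *\<^sub>R b) \<le> w (m + 0 *\<^sub>R b)" if "\<bar>s\<bar> < d" for s
        using m(2) inS[OF that] closure_subset by auto
    qed
    then show ?thesis by simp
  qed
  then have "laplacian f m \<le> (\<Sum>b\<in>(Basis::'a set). - 2 * e)"
    unfolding laplacian_sum[OF \<open>open S\<close> C2 \<open>m \<in> S\<close>] by (intro sum_mono) auto
  also have "\<dots> < 0" using \<open>e > 0\<close> by simp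
  finally show False using lap[OF \<open>m \<in> S\<close>] by simp
qed

lemma harmonic_unique:
  fixes f g :: "'a::euclidean_space \<Rightarrow> real"
  assumes "open S" "bounded S"
    and f: "Ck_on 2 S f" "continuous_on (closure S) f" "\<And>x. x \<in> S \<Longrightarrow> laplacian f x = 0"
    and g: "Ck_on 2 S g" "continuous_on (closure S) g" "\<And>x. x \<in> S \<Longrightarrow> laplacian g x = 0"
    and eq: "\<And>x. x \<in> frontier S \<Longrightarrow> f x = g x"
    and x: "x \<in> closure S"
  shows "f x = g x"
proof -
  have "f x - g x \<le> 0"
    by (rule weak_maximum_principle[OF assms(1,2) Ck_on_diff[OF assms(1) f(1) g(1)] _ _ _ x])
      (use assms in \<open>auto simp: laplacian_diff[OF assms(1) f(1) g(1)] intro!: continuous_intros\<close>)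
  moreover have "g x - f x \<le> 0"
    by (rule weak_maximum_principle[OF assms(1,2) Ck_on_diff[OF assms(1) g(1) f(1)] _ _ _ x])
      (use assms in \<open>auto simp: laplacian_diff[OF assms(1) g(1) f(1)] intro!: continuous_intros\<close>)
  ultimately show ?thesis by simp
qed

section \<open>Star-shaped plane domains\<close>

lemma norm_circ [simp]: "norm (circ \<theta>) = 1"
  by (simp add: circ_def norm_eq_sqrt_inner inner_vec_def sum_2 power2_eq_square[symmetric])

lemma S1_circ: "S1 = range circ"
proof
  show "S1 \<subseteq> range circ"
  proof
    fix x :: "real^2" assume "x \<in> S1"
    then have "(x $ 1)\<^sup>2 + (x $ 2)\<^sup>2 = 1"
      by (simp add: norm_eq_sqrt_inner inner_vec_def sum_2 power2_eq_square)
    then obtain t where "x $ 1 = cos t" "x $ 2 = sin t"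
      using sincos_total_2pi by metis
    then have "x = circ t" by (simp add: circ_def vec_eq_iff forall_2)
    then show "x \<in> range circ" by blast
  qed
qed auto

lemma circ_add: "circ (\<theta> + s) = cos s *\<^sub>R circ \<theta> + sin s *\<^sub>R rot90 (circ \<theta>)"
  by (simp add: circ_def rot90_def vec_eq_iff forall_2 cos_add sin_add algebra_simps)

lemma rot90_inner [simp]: "rot90 x \<bullet> x = 0" "x \<bullet> rot90 x = 0" "rot90 x \<bullet> rot90 y = x \<bullet> y"
  by (simp_all add: rot90_def inner_vec_def sum_2)

lemma norm_rot90 [simp]: "norm (rot90 x) = norm x"
  by (simp add: norm_eq_sqrt_inner)

lemma rot90_decomp:
  assumes "norm x = 1"
  shows "v = (v \<bullet> x) *\<^sub>R x + (v \<bullet> rot90 x) *\<^sub>R rot90 x"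
proof -
  have "(x $ 1)\<^sup>2 + (x $ 2)\<^sup>2 = 1"
    using assms by (simp add: norm_eq_sqrt_inner inner_vec_def sum_2 power2_eq_square)
  then show ?thesis
    by (simp add: rot90_def inner_vec_def sum_2 vec_eq_iff forall_2) algebra
qed

text \<open>The polar angle of \<open>z\<close>, on the half-plane of directions less than \<open>\<pi>/2\<close> away from \<open>\<theta>\<close>.\<close>

definition local_angle :: "real \<Rightarrow> real^2 \<Rightarrow> real" where
  "local_angle \<theta> z = \<theta> + arctan ((z \<bullet> rot90 (circ \<theta>)) / (z \<bullet> circ \<theta>))"

text \<open>The arctangent formulas for cosine and sine give the two components of \<open>z\<close>
  divided by its norm. Consequently \<open>h (sgn z)\<close> is locally a function of a real angle,
  which can be differentiated although \<open>h\<close> is controlled only through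
  \<open>circ\<close>.\<close>

lemma circ_local_angle:
  assumes "z \<bullet> circ \<theta> > 0"
  shows "circ (local_angle \<theta> z) = sgn z"
proof -
  let ?a = "z \<bullet> circ \<theta>" and ?b = "z \<bullet> rot90 (circ \<theta>)"
  have z: "z = ?a *\<^sub>R circ \<theta> + ?b *\<^sub>R rot90 (circ \<theta>)"
    by (rule rot90_decomp) simp
  have "norm z = sqrt (z \<bullet> z)" by (rule norm_eq_sqrt_inner)
  also have "z \<bullet> z = ?a\<^sup>2 + ?b\<^sup>2"
    by (subst (2) z) (simp add: inner_add_right power2_eq_square)
  also have "\<dots> = ?a\<^sup>2 * (1 + (?b / ?a)\<^sup>2)"
    using assms by (simp add: field_simps)
  finally have n: "norm z = ?a * sqrt (1 + (?b / ?a)\<^sup>2)"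
    using assms by (simp add: real_sqrt_mult)
  have pos: "sqrt (1 + (?b / ?a)\<^sup>2) > 0" by (simp add: add_pos_nonneg)
  have "circ (local_angle \<theta> z) = (1 / sqrt (1 + (?b / ?a)\<^sup>2)) *\<^sub>R circ \<theta> +
      (?b / ?a / sqrt (1 + (?b / ?a)\<^sup>2)) *\<^sub>R rot90 (circ \<theta>)"
    unfolding local_angle_def circ_add cos_arctan sin_arctan ..
  also have "\<dots> = (?a / norm z) *\<^sub>R circ \<theta> + (?b / norm z) *\<^sub>R rot90 (circ \<theta>)"
    unfolding n using assms pos by simp
  also have "\<dots> = sgn z"
  proof -
    have "sgn z = (1 / norm z) *\<^sub>R (?a *\<^sub>R circ \<theta> + ?b *\<^sub>R rot90 (circ \<theta>))"
      unfolding z[symmetric] by (simp add: sgn_div_norm divide_inverse)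
    then show ?thesis by (simp add: scaleR_add_right)
  qed
  finally show ?thesis .
qed

text \<open>On the half of the circle facing \<open>x\<close>, the map \<open>f\<close> is the
  composition of its pullback along \<open>circ\<close> with the continuous local angle.\<close>

lemma continuous_on_S1_if_circ:
  fixes f :: "real^2 \<Rightarrow> 'b::topological_space"
  assumes "continuous_on UNIV (\<lambda>\<theta>. f (circ \<theta>))"
  shows "continuous_on S1 f"
  unfolding continuous_on_eq_continuous_within
proof
  fix x assume "x \<in> S1"
  then obtain \<theta> where x: "x = circ \<theta>" using S1_circ by blast
  let ?W = "{z. z \<bullet> x > 0}"
  have "open ?W" by (intro open_Collect_less continuous_intros)
  have "continuous_on ?W (local_angle \<theta>)"
    unfolding local_angle_def x by (intro continuous_intros) auto
  then have "continuous_on (S1 \<inter> ?W) (local_angle \<theta>)"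
    by (rule continuous_on_subset) simp
  from continuous_on_compose2[OF assms this]
  have "continuous_on (S1 \<inter> ?W) (\<lambda>z. f (circ (local_angle \<theta> z)))" by simp
  moreover have "f (circ (local_angle \<theta> z)) = f z" if "z \<in> S1 \<inter> ?W" for z
    using that circ_local_angle[of z \<theta>] by (simp add: x sgn_div_norm)
  ultimately have "continuous_on (S1 \<inter> ?W) f"
    by (metis (no_types, lifting) continuous_on_cong)
  moreover have "x \<in> S1 \<inter> ?W"
    using norm_eq_1[of x] \<open>x \<in> S1\<close> by simp
  ultimately have "continuous (at x within S1 \<inter> ?W) f"
    by (simp add: continuous_on_eq_continuous_within del: Int_iff)
  moreover have "at x within S1 \<inter> ?W = at x within S1"
    by (rule at_within_nhd[of x ?W]) (use \<open>open ?W\<close> \<open>x \<in> S1 \<inter> ?W\<close> in auto)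
  ultimately show "continuous (at x within S1) f" by simp
qed

section \<open>Topology of a star-shaped domain through its gauge\<close>

locale star_shape =
  fixes h :: "real^2 \<Rightarrow> real"
  assumes gt: "\<And>x. x \<in> S1 \<Longrightarrow> h x > -1" and cont: "continuous_on S1 h"
begin

text \<open>At the origin, where \<open>sgn 0 = 0\<close> is not a point of the circle, the value is still
  \<open>0\<close> because the numerator vanishes.\<close>

definition gauge where "gauge y = norm y / (1 + h (sgn y))"

lemma sgn_S1: "y \<noteq> 0 \<Longrightarrow> sgn y \<in> S1"
  by (simp add: norm_sgn)

lemma gauge_scaleR: "c \<ge> 0 \<Longrightarrow> gauge (c *\<^sub>R y) = c * gauge y"
  by (cases "c = 0") (auto simp: gauge_def sgn_scaleR)

lemma gauge_bdry_param [simp]: "x \<in> S1 \<Longrightarrow> gauge (bdry_param h x) = 1"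
  using gt[of x] by (auto simp: gauge_def bdry_param_def sgn_scaleR sgn_div_norm)

lemma radius_bounds:
  obtains m M where "m > 0" "\<And>x. x \<in> S1 \<Longrightarrow> m \<le> 1 + h x \<and> 1 + h x \<le> M"
proof -
  have "compact (h ` S1)" by (intro compact_continuous_image cont) simp
  moreover have "S1 \<noteq> {}" using S1_circ by auto
  ultimately obtain a b where a: "a \<in> h ` S1" "\<And>x. x \<in> S1 \<Longrightarrow> a \<le> h x" and b: "\<And>x. x \<in> S1 \<Longrightarrow> h x \<le> b"
    using compact_attains_inf[of "h ` S1"] compact_attains_sup[of "h ` S1"] by (metis imageI image_is_empty)
  from a(1) gt have "a > -1" by auto
  then show thesis using that[of "1 + a" "1 + b"] a b by auto
qed

text \<open>Away from the origin this is composition with \<open>sgn\<close>. At the origin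
  \<open>sgn\<close> jumps, and the bound by \<open>norm z / m\<close>, with \<open>m\<close> a
  positive lower bound of the radius, takes over.\<close>

lemma continuous_gauge: "continuous_on UNIV gauge"
proof -
  have "isCont gauge y" for y
  proof (cases "y = 0")
    case True
    obtain m M where "m > 0" and m: "\<And>x. x \<in> S1 \<Longrightarrow> m \<le> 1 + h x \<and> 1 + h x \<le> M"
      using radius_bounds by metis
    have "(gauge \<longlongrightarrow> 0) (at 0)"
    proof (rule Lim_null_comparison)
      show "\<forall>\<^sub>F z in at 0. norm (gauge z) \<le> norm z / m"
      proof (rule eventuallyI)
        fix z
        show "norm (gauge z) \<le> norm z / m"
          using m[OF sgn_S1, of z] \<open>m > 0\<close>
          by (cases "z = 0") (auto simp: gauge_def intro!: divide_left_mono mult_pos_pos)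
      qed
      show "((\<lambda>z. norm z / m) \<longlongrightarrow> 0) (at 0)"
        using \<open>m > 0\<close> by (auto intro!: tendsto_eq_intros)
    qed
    with True show ?thesis by (simp add: isCont_def gauge_def)
  next
    case False
    have "continuous_on (- {0}) (\<lambda>y. h (sgn y))"
      by (rule continuous_on_compose2[OF cont]) (auto intro!: continuous_intros simp: norm_sgn split: if_splits)
    then have "isCont (\<lambda>y. h (sgn y)) y"
      using False continuous_on_eq_continuous_at[of "- {0}"] by auto
    moreover have "1 + h (sgn y) \<noteq> 0" using gt[OF sgn_S1[OF False]] by simp
    ultimately show ?thesis unfolding gauge_def[abs_def] by (intro continuous_intros)
  qed
  then show ?thesis by (simp add: continuous_at_imp_continuous_on)
qed

lemma star_domain_gauge: "star_domain h = {y. gauge y < 1}"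
proof safe
  fix y assume "y \<in> star_domain h"
  then obtain r x where "y = r *\<^sub>R bdry_param h x" "0 \<le> r" "r < 1" "x \<in> S1"
    unfolding star_domain_def by blast
  then show "gauge y < 1" by (simp add: gauge_scaleR del: mem_sphere)
next
  fix y assume y: "gauge y < 1"
  show "y \<in> star_domain h"
  proof (cases "y = 0")
    case True
    then have "y = 0 *\<^sub>R bdry_param h (circ 0)" by simp
    then show ?thesis unfolding star_domain_def
      by (intro CollectI exI[of _ 0] exI[of _ "circ 0"]) simp
  next
    case False
    have "gauge y *\<^sub>R bdry_param h (sgn y) = y" "0 \<le> gauge y"
      using gt[OF sgn_S1[OF False]] False by (auto simp: gauge_def bdry_param_def sgn_div_norm)
    then show ?thesis using y sgn_S1[OF False] unfolding star_domain_def
      by (intro CollectI exI[of _ "gauge y"] exI[of _ "sgn y"]) auto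
  qed
qed

lemma star_domain_iff: "y \<in> star_domain h \<longleftrightarrow> y = 0 \<or> norm y < 1 + h (sgn y)"
  using gt[OF sgn_S1, of y] by (cases "y = 0") (simp_all add: star_domain_gauge gauge_def field_simps)

lemma gauge_eq_1: "{y. gauge y = 1} = bdry_param h ` S1"
proof safe
  fix y assume y: "gauge y = 1"
  then have "y \<noteq> 0" by (auto simp: gauge_def)
  then have "bdry_param h (sgn y) = y"
    using y gt[OF sgn_S1] by (auto simp: gauge_def bdry_param_def sgn_div_norm field_simps)
  then show "y \<in> bdry_param h ` S1" using sgn_S1[OF \<open>y \<noteq> 0\<close>] by (metis imageI)
qed (use gauge_bdry_param in blast)

lemma open_star_domain: "open (star_domain h)"
  using continuous_gauge by (simp add: star_domain_gauge open_Collect_less)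

text \<open>By positive homogeneity of the gauge, shrinking a point of gauge at most 1 by factors
  below 1 tending to 1 approximates it from inside the domain.\<close>

lemma closure_star_domain: "closure (star_domain h) = {y. gauge y \<le> 1}"
proof
  have "closed {y. gauge y \<le> 1}" using continuous_gauge by (simp add: closed_Collect_le)
  then show "closure (star_domain h) \<subseteq> {y. gauge y \<le> 1}"
    by (intro closure_minimal) (auto simp: star_domain_gauge)
  show "{y. gauge y \<le> 1} \<subseteq> closure (star_domain h)"
  proof safe
    fix y assume y: "gauge y \<le> 1"
    define c where "c n = 1 - inverse (real (Suc n))" for n
    have c: "0 \<le> c n" "c n < 1" for n by (auto simp: c_def field_simps)
    have "c n *\<^sub>R y \<in> star_domain h" for n
    proof -
      have "gauge y \<ge> 0" using gt[OF sgn_S1, of y] by (cases "y = 0") (auto simp: gauge_def)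
      then have "c n * gauge y \<le> c n" using c[of n] y by (simp add: mult_left_le)
      then show ?thesis using c[of n] by (simp add: star_domain_gauge gauge_scaleR)
    qed
    moreover have "(\<lambda>n. c n *\<^sub>R y) \<longlonglongrightarrow> (1 - 0) *\<^sub>R y"
      unfolding c_def by (intro tendsto_intros LIMSEQ_inverse_real_of_nat)
    ultimately show "y \<in> closure (star_domain h)"
      unfolding closure_sequential by (intro exI[of _ "\<lambda>n. c n *\<^sub>R y"]) simp
  qed
qed

lemma frontier_star_domain: "frontier (star_domain h) = bdry_param h ` S1"
proof -
  have "frontier (star_domain h) = {y. gauge y \<le> 1} - {y. gauge y < 1}"
    unfolding frontier_def closure_star_domain interior_open[OF open_star_domain]
    by (simp only: star_domain_gauge)
  also have "\<dots> = {y. gauge y = 1}" by auto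
  finally show ?thesis by (simp only: gauge_eq_1)
qed

lemma bounded_star_domain: "bounded (star_domain h)"
proof -
  obtain m M where M: "\<And>x. x \<in> S1 \<Longrightarrow> m \<le> 1 + h x \<and> 1 + h x \<le> M" "m > 0"
    using radius_bounds by metis
  have "norm y \<le> M" if y: "y \<in> star_domain h" for y
  proof -
    obtain r x where "y = r *\<^sub>R bdry_param h x" "0 \<le> r" "r < 1" "x \<in> S1"
      using y unfolding star_domain_def by blast
    moreover from this have "0 \<le> 1 + h x" "1 + h x \<le> M"
      using M(1)[of x] gt[of x] by auto
    moreover from calculation have "r * (1 + h x) \<le> 1 * M" by (intro mult_mono) auto
    ultimately show ?thesis by (auto simp: bdry_param_def)
  qed
  then show ?thesis by (auto simp: bounded_iff)
qed

lemma bdry_param_mem: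
  assumes "x \<in> S1"
  shows "bdry_param h x \<in> frontier (star_domain h)" "bdry_param h x \<in> closure (star_domain h)"
    "bdry_param h x \<notin> star_domain h"
  using gauge_bdry_param[OF assms] assms
  by (simp_all only: frontier_star_domain closure_star_domain) (auto simp: star_domain_gauge)

end

section \<open>The outward normal\<close>

text \<open>The cross product \<open>?s\<close> annihilates the nonzero \<open>g\<close>, so it is
  0. Lagrange's identity then makes the inner product of the two unit vectors 1 or -1.\<close>

lemma orthogonal_unit_vectors_real2:
  fixes n m g :: "real^2"
  assumes "n \<bullet> g = 0" "m \<bullet> g = 0" "g \<noteq> 0" "norm n = 1" "norm m = 1"
  shows "m = n \<or> m = - n"
proof -
  let ?s = "n $ 1 * m $ 2 - n $ 2 * m $ 1"
  have *: "n $ 1 * g $ 1 + n $ 2 * g $ 2 = 0" "m $ 1 * g $ 1 + m $ 2 * g $ 2 = 0"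
    "(n $ 1)\<^sup>2 + (n $ 2)\<^sup>2 = 1" "(m $ 1)\<^sup>2 + (m $ 2)\<^sup>2 = 1"
    using assms by (simp_all add: norm_eq_sqrt_inner inner_vec_def sum_2 power2_eq_square)
  have "?s * g $ 1 = 0" "?s * g $ 2 = 0" using *(1,2) by algebra+
  moreover have "g $ 1 \<noteq> 0 \<or> g $ 2 \<noteq> 0" using assms(3) by (simp add: vec_eq_iff forall_2)
  ultimately have "?s = 0" by auto
  then have "(n \<bullet> m)\<^sup>2 = 1"
    using *(3,4) by (simp add: inner_vec_def sum_2) algebra
  then have "n \<bullet> m = 1 \<or> n \<bullet> m = -1" by (simp add: power2_eq_1_iff)
  moreover have "(m - n) \<bullet> (m - n) = 2 - 2 * (n \<bullet> m)" "(m + n) \<bullet> (m + n) = 2 + 2 * (n \<bullet> m)"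
    using assms(4,5) by (simp_all add: algebra_simps inner_commute norm_eq_1)
  ultimately have "(m - n) \<bullet> (m - n) = 0 \<or> (m + n) \<bullet> (m + n) = 0" by auto
  then have "m - n = 0 \<or> m + n = 0" unfolding inner_eq_zero_iff .
  then show ?thesis by (simp add: eq_neg_iff_add_eq_0)
qed

text \<open>The inner product of \<open>n\<close> with the difference quotient \<open>q\<close>
  equals that with the normalized secant times \<open>norm (q s)\<close>, so it tends to 0 and also
  to \<open>n \<bullet> \<gamma>'\<close>. Since \<gamma>' is nonzero, the secants are eventually
  nonzero; approaching from the right keeps \<open>s - \<theta>\<close> positive.\<close>

lemma secant_limit_orthogonal:
  fixes \<gamma> :: "real \<Rightarrow> 'a::real_inner"
  assumes lim: "((\<lambda>z. n \<bullet> (z - y) / norm (z - y)) \<longlongrightarrow> 0) (at y within A)"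
    and \<gamma>: "(\<gamma> has_vector_derivative \<gamma>') (at \<theta>)" "\<gamma> \<theta> = y" "\<And>s. \<gamma> s \<in> A"
    and "\<gamma>' \<noteq> 0"
  shows "n \<bullet> \<gamma>' = 0"
proof -
  define q where "q s = (\<gamma> s - y) /\<^sub>R (s - \<theta>)" for s
  have q: "(q \<longlongrightarrow> \<gamma>') (at_right \<theta>)"
  proof -
    have "((\<lambda>s. (1 / norm (s - \<theta>)) *\<^sub>R (\<gamma> s - (\<gamma> \<theta> + (s - \<theta>) *\<^sub>R \<gamma>'))) \<longlongrightarrow> 0) (at_right \<theta>)"
      using has_vector_derivative_at_within[OF \<gamma>(1), of "{\<theta><..}"]
      by (simp add: has_vector_derivative_def has_derivative_within)
    moreover have "\<forall>\<^sub>F s in at_right \<theta>.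
        (1 / norm (s - \<theta>)) *\<^sub>R (\<gamma> s - (\<gamma> \<theta> + (s - \<theta>) *\<^sub>R \<gamma>')) = q s - \<gamma>'"
      using eventually_at_right_less[of \<theta>]
    proof eventually_elim
      case (elim s)
      then show ?case
        by (simp add: q_def \<gamma>(2) inverse_eq_divide scaleR_diff_right scaleR_add_right diff_diff_eq)
    qed
    ultimately have "((\<lambda>s. q s - \<gamma>') \<longlongrightarrow> 0) (at_right \<theta>)"
      by (simp add: tendsto_cong)
    then show ?thesis by (rule LIM_zero_cancel)
  qed
  have "\<forall>\<^sub>F s in at_right \<theta>. q s \<noteq> 0"
    using tendsto_imp_eventually_ne[OF q \<open>\<gamma>' \<noteq> 0\<close>] .
  then have ne: "\<forall>\<^sub>F s in at_right \<theta>. \<gamma> s \<noteq> y"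
    by eventually_elim (auto simp: q_def)
  have "(\<gamma> \<longlongrightarrow> y) (at_right \<theta>)"
    using has_vector_derivative_continuous[OF \<gamma>(1)] \<gamma>(2)
    by (metis continuous_within filterlim_at_split)
  then have "filterlim \<gamma> (at y within A) (at_right \<theta>)"
    using ne \<gamma>(3) by (simp add: filterlim_at)
  from filterlim_compose[OF lim this]
  have "((\<lambda>s. n \<bullet> (\<gamma> s - y) / norm (\<gamma> s - y) * norm (q s)) \<longlongrightarrow> 0 * norm \<gamma>') (at_right \<theta>)"
    by (intro tendsto_mult tendsto_norm q)
  moreover have "\<forall>\<^sub>F s in at_right \<theta>. n \<bullet> (\<gamma> s - y) / norm (\<gamma> s - y) * norm (q s) = n \<bullet> q s"
    using ne eventually_at_right_less[of \<theta>]
  proof eventually_elim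
    case (elim s)
    then have "norm (q s) = norm (\<gamma> s - y) / (s - \<theta>)" "n \<bullet> q s = n \<bullet> (\<gamma> s - y) / (s - \<theta>)"
      by (simp_all add: q_def divide_inverse mult.commute)
    with elim show ?case by simp
  qed
  ultimately have "((\<lambda>s. n \<bullet> q s) \<longlongrightarrow> 0) (at_right \<theta>)"
    by (simp add: tendsto_cong)
  moreover have "((\<lambda>s. n \<bullet> q s) \<longlongrightarrow> n \<bullet> \<gamma>') (at_right \<theta>)"
    by (intro tendsto_intros q)
  ultimately show ?thesis
    using tendsto_unique trivial_limit_at_right_real by blast
qed

text \<open>Here \<open>c *\<^sub>R n\<close> is the gradient of a local defining function
  \<open>g\<close>. Since \<open>g\<close> increases along \<open>n\<close>, that direction leaves
  the closure, while \<open>- n\<close> enters it. The curve \<gamma> makes the frontier rich enough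
  for uniqueness: any candidate is orthogonal to its tangent, hence is \<open>n\<close> or
  \<open>- n\<close>.\<close>

lemma outward_unit_normal_level_set:
  fixes S :: "(real^2) set"
  assumes g: "(g has_derivative (\<lambda>v. c * (v \<bullet> n))) (at y)" "g y = 0"
    and "c > 0" "norm n = 1"
    and W: "open W" "y \<in> W"
    and cl: "\<And>z. z \<in> W \<Longrightarrow> z \<in> closure S \<longleftrightarrow> g z \<le> 0"
    and fr: "\<And>z. z \<in> W \<Longrightarrow> z \<in> frontier S \<Longrightarrow> g z = 0"
    and \<gamma>: "(\<gamma> has_vector_derivative \<gamma>') (at \<theta>)" "\<gamma> \<theta> = y" "\<And>s. \<gamma> s \<in> frontier S" "\<gamma>' \<noteq> 0"
  shows "outward_unit_normal S y = n"
  unfolding outward_unit_normal_def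
proof (rule the_equality)
  have inW: "\<forall>\<^sub>F s in at_right 0. y + s *\<^sub>R v \<in> W" for v :: "real^2"
  proof -
    have "((\<lambda>s. y + s *\<^sub>R v) \<longlongrightarrow> y + 0 *\<^sub>R v) (at_right 0)" by (intro tendsto_intros)
    then show ?thesis using W topological_tendstoD by fastforce
  qed
  have line: "((\<lambda>s. g (y + s *\<^sub>R v)) has_real_derivative c * (v \<bullet> n)) (at 0)" for v
    by (rule has_derivative_line) (use g in simp)
  have out: "\<forall>\<^sub>F s in at_right 0. y + s *\<^sub>R n \<notin> closure S"
  proof -
    have "c * (n \<bullet> n) > 0" using \<open>c > 0\<close> \<open>norm n = 1\<close> by (simp add: norm_eq_1)
    from DERIV_pos_inc_right[OF line this] obtain d where
      "d > 0" "\<And>s. 0 < s \<Longrightarrow> s < d \<Longrightarrow> g (y + s *\<^sub>R n) > 0" using g(2) by auto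
    then have "\<forall>\<^sub>F s in at_right 0. g (y + s *\<^sub>R n) > 0"
      by (auto simp: eventually_at_right_field)
    with inW[of n] show ?thesis by eventually_elim (auto simp: cl)
  qed
  have inside: "\<forall>\<^sub>F s in at_right 0. y + s *\<^sub>R (- n) \<in> closure S"
  proof -
    have "c * (- n \<bullet> n) < 0" using \<open>c > 0\<close> \<open>norm n = 1\<close> by (simp add: norm_eq_1)
    from DERIV_neg_dec_right[OF line this] obtain d where
      "d > 0" "\<And>s. 0 < s \<Longrightarrow> s < d \<Longrightarrow> g (y + s *\<^sub>R (- n)) < 0" using g(2) by auto
    then have "\<forall>\<^sub>F s in at_right 0. g (y + s *\<^sub>R (- n)) < 0"
      by (auto simp: eventually_at_right_field)
    with inW[of "- n"] show ?thesis by eventually_elim (auto simp: cl)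
  qed
  have lim: "((\<lambda>z. n \<bullet> (z - y) / norm (z - y)) \<longlongrightarrow> 0) (at y within frontier S)"
  proof -
    have "((\<lambda>z. (1 / norm (z - y)) *\<^sub>R (g z - (g y + c * ((z - y) \<bullet> n)))) \<longlongrightarrow> 0) (at y within frontier S)"
      using has_derivative_at_withinI[OF g(1)] by (simp add: has_derivative_within)
    then have "((\<lambda>z. (- 1 / c) * ((1 / norm (z - y)) *\<^sub>R (g z - (g y + c * ((z - y) \<bullet> n))))) \<longlongrightarrow> 0)
        (at y within frontier S)"
      by (rule tendsto_mult_right_zero)
    \<comment> \<open>On the frontier \<open>g z\<close> and \<open>g y\<close> both vanish, so the
      linearization error is just \<open>- c * ((z - y) \<bullet> n)\<close>.\<close>
    moreover have "\<forall>\<^sub>F z in at y within frontier S.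
        (- 1 / c) * ((1 / norm (z - y)) *\<^sub>R (g z - (g y + c * ((z - y) \<bullet> n)))) = n \<bullet> (z - y) / norm (z - y)"
      using eventually_at_topological W fr \<open>c > 0\<close> g(2)
      by (fastforce simp: eventually_at_topological inner_commute)
    ultimately show ?thesis by (simp add: tendsto_cong)
  qed
  show "norm n = 1 \<and> ((\<lambda>z. n \<bullet> (z - y) / norm (z - y)) \<longlongrightarrow> 0) (at y within frontier S) \<and>
      (\<forall>\<^sub>F s in at_right 0. y + s *\<^sub>R n \<notin> closure S)"
    using lim out \<open>norm n = 1\<close> by blast
  fix m
  assume m: "norm m = 1 \<and> ((\<lambda>z. m \<bullet> (z - y) / norm (z - y)) \<longlongrightarrow> 0) (at y within frontier S) \<and>
      (\<forall>\<^sub>F s in at_right 0. y + s *\<^sub>R m \<notin> closure S)"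
  have "n \<bullet> \<gamma>' = 0" "m \<bullet> \<gamma>' = 0"
    using secant_limit_orthogonal[OF _ \<gamma>] lim m by blast+
  then have "m = n \<or> m = - n"
    using orthogonal_unit_vectors_real2 \<gamma>(4) \<open>norm n = 1\<close> m by blast
  moreover have "m \<noteq> - n"
  proof
    assume "m = - n"
    with m have "\<forall>\<^sub>F s in at_right 0. y + s *\<^sub>R (- n) \<notin> closure S" by blast
    with inside have "\<forall>\<^sub>F s in at_right (0::real). False" by eventually_elim simp
    then show False using trivial_limit_at_right_real unfolding trivial_limit_def by blast
  qed
  ultimately show "m = n" by blast
qed

lemma circ_has_vector_derivative: "(circ has_vector_derivative rot90 (circ \<theta>)) (at \<theta>)"
proof -
  have "circ s = cos s *\<^sub>R circ 0 + sin s *\<^sub>R rot90 (circ 0)" for s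
    using circ_add[of 0 s] by simp
  then have "circ = (\<lambda>s. cos s *\<^sub>R circ 0 + sin s *\<^sub>R rot90 (circ 0))"
    by (rule ext)
  moreover have "rot90 (circ \<theta>) = (- sin \<theta>) *\<^sub>R circ 0 + cos \<theta> *\<^sub>R rot90 (circ 0)"
    by (simp add: circ_def rot90_def vec_eq_iff forall_2)
  moreover have "((\<lambda>s. cos s *\<^sub>R circ 0 + sin s *\<^sub>R rot90 (circ 0)) has_vector_derivative
      (- sin \<theta>) *\<^sub>R circ 0 + cos \<theta> *\<^sub>R rot90 (circ 0)) (at \<theta>)"
    by (auto intro!: derivative_eq_intros)
  ultimately show ?thesis by metis
qed

lemma tangential_grad_circ:
  assumes "((\<lambda>\<theta>. f (circ \<theta>)) has_real_derivative d) (at \<theta>)"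
  shows "tangential_grad f (circ \<theta>) = d *\<^sub>R rot90 (circ \<theta>)"
proof -
  have "((\<lambda>s. f (circ (\<theta> + s))) has_real_derivative d) (at 0)"
    using assms DERIV_shift[of "\<lambda>\<theta>. f (circ \<theta>)" d 0 \<theta>] by (simp add: add.commute)
  then show ?thesis
    unfolding tangential_grad_def circ_add[symmetric] by (simp add: DERIV_imp_deriv)
qed

lemma local_angle_has_derivative:
  assumes "r > 0"
  shows "(local_angle \<theta> has_derivative (\<lambda>v. v \<bullet> rot90 (circ \<theta>) / r)) (at (r *\<^sub>R circ \<theta>))"
proof -
  have "circ \<theta> \<bullet> circ \<theta> = 1" using norm_circ[of \<theta>] by (simp only: norm_eq_1)
  then show ?thesis unfolding local_angle_def[abs_def]
    using assms by (auto intro!: derivative_eq_intros simp: field_simps)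
qed

context star_shape
begin

lemma closure_star_domain_iff:
  "y \<noteq> 0 \<Longrightarrow> y \<in> closure (star_domain h) \<longleftrightarrow> norm y \<le> 1 + h (sgn y)"
  using gt[OF sgn_S1, of y] by (simp add: closure_star_domain gauge_def field_simps)

lemma frontier_star_domain_iff:
  "y \<noteq> 0 \<Longrightarrow> y \<in> frontier (star_domain h) \<longleftrightarrow> norm y = 1 + h (sgn y)"
  unfolding frontier_star_domain gauge_eq_1[symmetric]
  using gt[OF sgn_S1, of y] by (auto simp: gauge_def field_simps)

text \<open>The defining function is the norm minus the radius in the direction of the local angle.
  Its gradient at the boundary point is \<open>circ \<theta>\<close> minus \<open>h' / r\<close>
  times the tangent vector; this has length \<open>?J / r\<close>, which is the constant
  \<open>c\<close> passed to the level set lemma.\<close>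

lemma outward_unit_normal_star_domain:
  assumes h': "((\<lambda>\<theta>. h (circ \<theta>)) has_real_derivative h') (at \<theta>)"
  defines "r \<equiv> 1 + h (circ \<theta>)"
  shows "outward_unit_normal (star_domain h) (bdry_param h (circ \<theta>)) =
    (r *\<^sub>R circ \<theta> - h' *\<^sub>R rot90 (circ \<theta>)) /\<^sub>R sqrt (r\<^sup>2 + h'\<^sup>2)"
proof -
  let ?x = "circ \<theta>" and ?\<tau> = "rot90 (circ \<theta>)"
  let ?J = "sqrt (r\<^sup>2 + h'\<^sup>2)"
  let ?n = "(r *\<^sub>R ?x - h' *\<^sub>R ?\<tau>) /\<^sub>R ?J"
  let ?g = "\<lambda>z. norm z - (1 + h (circ (local_angle \<theta> z)))"
  let ?W = "{z. z \<bullet> ?x > 0}"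
  let ?y = "bdry_param h ?x"
  have r: "r > 0" using gt[of ?x] by (simp add: r_def)
  have y: "?y = r *\<^sub>R ?x" by (simp add: bdry_param_def r_def)
  have xx: "?x \<bullet> ?x = 1" using norm_circ[of \<theta>] by (simp only: norm_eq_1)
  then have x0: "?x \<noteq> 0" by auto
  have J: "?J > 0" using r by (simp add: add_pos_nonneg)
  have Jsq: "?J * ?J = r\<^sup>2 + h'\<^sup>2" by simp
  have ang: "local_angle \<theta> ?y = \<theta>" by (simp add: y local_angle_def)
  show ?thesis
  proof (rule outward_unit_normal_level_set[where g = ?g and W = ?W and c = "?J / r"
        and \<gamma> = "\<lambda>s. bdry_param h (circ s)" and \<theta> = \<theta>
        and \<gamma>' = "r *\<^sub>R ?\<tau> + h' *\<^sub>R ?x"])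
    have "(norm has_derivative (\<lambda>v. v \<bullet> sgn ?y)) (at ?y)"
      by (rule has_derivative_norm) (use r y x0 in auto)
    moreover have "sgn ?y = ?x" using r by (simp add: y sgn_scaleR sgn_div_norm)
    moreover have "((\<lambda>z. h (circ (local_angle \<theta> z))) has_derivative (\<lambda>v. h' * (v \<bullet> ?\<tau> / r))) (at ?y)"
      by (rule has_derivative_compose[OF local_angle_has_derivative[OF r, of \<theta>, folded y],
            of "\<lambda>\<theta>. h (circ \<theta>)"])
        (use h' ang in \<open>simp add: has_field_derivative_def\<close>)
    ultimately have "(?g has_derivative (\<lambda>v. v \<bullet> ?x - h' * (v \<bullet> ?\<tau> / r))) (at ?y)"
      by (auto intro!: derivative_eq_intros)
    moreover have "(\<lambda>v. v \<bullet> ?x - h' * (v \<bullet> ?\<tau> / r)) = (\<lambda>v. ?J / r * (v \<bullet> ?n))"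
      using r J by (simp add: fun_eq_iff inner_diff_right field_simps)
    ultimately show "(?g has_derivative (\<lambda>v. ?J / r * (v \<bullet> ?n))) (at ?y)" by simp
    show "?g ?y = 0" using r by (simp add: ang) (simp add: y r_def)
    show "?J / r > 0" using r J by simp
    have "(r *\<^sub>R ?x - h' *\<^sub>R ?\<tau>) \<bullet> (r *\<^sub>R ?x - h' *\<^sub>R ?\<tau>) = r\<^sup>2 + h'\<^sup>2"
      by (simp add: inner_diff_left inner_diff_right xx power2_eq_square)
    then have "norm (r *\<^sub>R ?x - h' *\<^sub>R ?\<tau>) = ?J" by (simp add: norm_eq_sqrt_inner)
    moreover have "norm ?n = norm (r *\<^sub>R ?x - h' *\<^sub>R ?\<tau>) / ?J"
      using J by (simp add: divide_inverse mult.commute)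
    ultimately have "norm ?n = ?J / ?J" by (simp only:)
    also have "\<dots> = 1" using J by (intro divide_self less_imp_neq[symmetric])
    finally show "norm ?n = 1" .
    show "open ?W" by (intro open_Collect_less continuous_intros)
    show "?y \<in> ?W" using r by (simp add: y xx)
    show "z \<in> closure (star_domain h) \<longleftrightarrow> ?g z \<le> 0" if "z \<in> ?W" for z
    proof -
      have "z \<noteq> 0" using that by auto
      then show ?thesis using that by (simp add: closure_star_domain_iff circ_local_angle)
    qed
    show "?g z = 0" if "z \<in> ?W" "z \<in> frontier (star_domain h)" for z
    proof -
      have "z \<noteq> 0" using that by auto
      then show ?thesis using that by (simp add: frontier_star_domain_iff circ_local_angle)
    qed
    show "((\<lambda>s. bdry_param h (circ s)) has_vector_derivative r *\<^sub>R ?\<tau> + h' *\<^sub>R ?x) (at \<theta>)"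
      unfolding bdry_param_def r_def
      by (auto intro!: derivative_eq_intros h' circ_has_vector_derivative)
    show "bdry_param h (circ s) \<in> frontier (star_domain h)" for s
      by (rule bdry_param_mem) simp
    have "(r *\<^sub>R ?\<tau> + h' *\<^sub>R ?x) \<bullet> ?\<tau> = r" by (simp add: inner_add_left xx)
    then show "r *\<^sub>R ?\<tau> + h' *\<^sub>R ?x \<noteq> 0" using r by auto
  qed simp
qed

end

section \<open>The equations in the domain and on its boundary\<close>

lemma dirichlet_solution_eq:
  assumes "star_shape h" and f: "dirichlet_solution h \<psi> f" and g: "dirichlet_solution h \<psi> g"
    and y: "y \<in> closure (star_domain h)"
  shows "f y = g y"
proof -
  interpret star_shape h by fact
  show ?thesis
    by (rule harmonic_unique[OF open_star_domain bounded_star_domain _ _ _ _ _ _ _ y])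
      (use f g in \<open>auto simp: dirichlet_solution_def frontier_star_domain simp del: mem_sphere\<close>)
qed

text \<open>The extension chosen by \<open>SOME\<close> is unknown outside the closed domain, so its
  gradient is compared with that of \<Phi> only at interior points. The inner limit is then the
  value of the continuous \<open>grad \<Phi>\<close>, and it is unique because the boundary point is
  a limit point of the domain.\<close>

lemma dirichlet_neumann_eq:
  assumes "star_shape h" and \<Phi>: "dirichlet_solution h \<psi> \<Phi>" and x: "x \<in> S1"
    and cont: "isCont (grad \<Phi>) (bdry_param h x)"
  shows "dirichlet_neumann h \<psi> x =
    grad \<Phi> (bdry_param h x) \<bullet> outward_unit_normal (star_domain h) (bdry_param h x)"
proof -
  interpret star_shape h by fact
  let ?E = "harmonic_extension h \<psi>" and ?y = "bdry_param h x"
  have E: "dirichlet_solution h \<psi> ?E"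
    unfolding harmonic_extension_def by (rule someI[where P = "dirichlet_solution h \<psi>", OF \<Phi>])
  have eq: "grad ?E z = grad \<Phi> z" if "z \<in> star_domain h" for z
    by (rule grad_cong[OF open_star_domain that])
      (use dirichlet_solution_eq[OF assms(1) E \<Phi>] closure_subset in blast)
  have "(grad \<Phi> \<longlongrightarrow> grad \<Phi> ?y) (at ?y within star_domain h)"
    using assms(4) unfolding isCont_def by (rule tendsto_within_subset) simp
  moreover have "\<forall>\<^sub>F z in at ?y within star_domain h. grad \<Phi> z = grad ?E z"
    using eq by (auto simp: eventually_at_filter)
  ultimately have "(grad ?E \<longlongrightarrow> grad \<Phi> ?y) (at ?y within star_domain h)"
    by (simp add: tendsto_cong)
  moreover have "at ?y within star_domain h \<noteq> bot"
    using bdry_param_mem[OF x] by (simp add: trivial_limit_within closure_def)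
  ultimately have "Lim (at ?y within star_domain h) (grad ?E) = grad \<Phi> ?y"
    by (intro tendsto_Lim)
  then show ?thesis by (simp add: dirichlet_neumann_def)
qed

text \<open>The formula for \<open>u\<close> is required separately for times near \<open>t\<close>
  at the fixed point \<open>y\<close>, and on the neighbourhood \<open>W\<close> at the fixed time
  \<open>t\<close>. This is what a velocity known only on moving domains can provide.\<close>

lemma euler_if_bernoulli:
  fixes F :: "real \<times> 'a::euclidean_space \<Rightarrow> real"
  assumes "open U" and C2: "Ck_on 2 U F" and ty: "(t, y) \<in> U"
    and us: "\<forall>\<^sub>F s in nhds t. u s y = grad (\<lambda>z. F (s, z)) y"
    and "open W" "y \<in> W" and ut: "\<And>z. z \<in> W \<Longrightarrow> u t z = grad (\<lambda>z. F (t, z)) z"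
    and p: "\<And>z. z \<in> W \<Longrightarrow>
      deriv (\<lambda>s. F (s, z)) t + 1/2 * (norm (grad (\<lambda>z. F (t, z)) z))\<^sup>2 + p z = c"
  shows "vector_derivative (\<lambda>s. u s y) (at t) + frechet_derivative (u t) (at y) (u t y) + grad p y = 0"
proof -
  \<comment> \<open>Here \<open>(1, 0)\<close> is the time direction and \<open>(0, b)\<close> a
    space direction; \<open>D\<close> gives first derivatives in space-time, \<open>H\<close> the
    Hessian at \<open>(t, y)\<close>, and \<open>G\<close> the spatial gradient.\<close>
  define D where "D v q = frechet_derivative F (at q) v" for v q
  define H where "H v w = frechet_derivative (D v) (at (t, y)) w" for v w
  define G where "G q = (\<Sum>b\<in>Basis. D (0, b) q *\<^sub>R b)" for q
  have dF: "(F has_derivative (\<lambda>v. D v q)) (at q)" if "q \<in> U" for q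
    using Ck_on_2_has_derivative(1)[OF C2 that] by (simp add: D_def)
  have dD: "(D v has_derivative H v) (at (t, y))" for v
    using Ck_on_2_has_derivative(2)[OF C2 ty] by (simp add: D_def[abs_def] H_def[abs_def])
  have sym: "H v w = H w v" for v w
    using second_derivative_symmetric[OF \<open>open U\<close> C2 ty] by (simp add: D_def[abs_def] H_def[abs_def])
  have lin: "linear (H v)" for v by (rule has_derivative_linear[OF dD])
  have dG: "(G has_derivative (\<lambda>v. \<Sum>b\<in>Basis. H (0, b) v *\<^sub>R b)) (at (t, y))"
    unfolding G_def[abs_def] by (intro has_derivative_sum has_derivative_scaleR_left dD)
  have grad_F: "grad (\<lambda>z. F (s, z)) z = G (s, z)" if "(s, z) \<in> U" for s z
    using GDERIV_grad(2)[OF has_derivative_slice(1)[OF dF[OF that]]] by (simp add: G_def)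
  have dt_F: "deriv (\<lambda>s. F (s, z)) t = D (1, 0) (t, z)" if "(t, z) \<in> U" for z
  proof -
    have "((\<lambda>s. F (s, z)) has_derivative (\<lambda>s. D (s, 0) (t, z))) (at t)"
      by (rule has_derivative_slice(2)[OF dF[OF that]])
    moreover have "(\<lambda>s. D (s, 0) (t, z)) = (*) (D (1, 0) (t, z))"
    proof
      fix s
      have "D (s *\<^sub>R (1, 0)) (t, z) = s *\<^sub>R D (1, 0) (t, z)"
        by (rule linear_cmul[OF has_derivative_linear[OF dF[OF that]]])
      then show "D (s, 0) (t, z) = D (1, 0) (t, z) * s" by (simp add: mult.commute)
    qed
    ultimately show ?thesis by (simp add: has_field_derivative_def DERIV_imp_deriv)
  qed
  define V where "V = W \<inter> {z. (t, z) \<in> U}"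
  have V: "open V" "y \<in> V"
    using open_Int[OF \<open>open W\<close> open_slice[OF \<open>open U\<close>]] \<open>y \<in> W\<close> ty by (auto simp: V_def)
  have "vector_derivative (\<lambda>s. u s y) (at t) = (\<Sum>b\<in>Basis. H (0, b) (1, 0) *\<^sub>R b)"
  proof -
    obtain T1 where T1: "open T1" "t \<in> T1" "\<And>s. s \<in> T1 \<Longrightarrow> u s y = grad (\<lambda>z. F (s, z)) y"
      using us unfolding eventually_nhds by blast
    define T where "T = T1 \<inter> {s. (s, y) \<in> U}"
    have "continuous_on UNIV (\<lambda>s. (s, y))" by (intro continuous_intros)
    from open_vimage[OF \<open>open U\<close> this] have T: "open T" "t \<in> T"
      unfolding T_def using T1 ty by (auto simp: vimage_def)
    have eq: "G (s, y) = u s y" if "s \<in> T" for s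
      using that T1(3)[of s] grad_F[of s y] by (simp add: T_def)
    have du: "((\<lambda>s. u s y) has_derivative (\<lambda>s. \<Sum>b\<in>Basis. H (0, b) (s, 0) *\<^sub>R b)) (at t)"
      by (rule has_derivative_transform_within_open[OF has_derivative_slice(2)[OF dG] T eq])
    have "H (0, b) (s, 0) *\<^sub>R b = s *\<^sub>R H (0, b) (1, 0) *\<^sub>R b" for b s
      using linear_cmul[OF lin, of "(0, b)" s "(1, 0)"] by simp
    then have "(\<lambda>s. \<Sum>b\<in>Basis. H (0, b) (s, 0) *\<^sub>R b) =
        (\<lambda>s. s *\<^sub>R (\<Sum>b\<in>Basis. H (0, b) (1, 0) *\<^sub>R b))"
      unfolding scaleR_sum_right by (intro ext sum.cong refl)
    from du[unfolded this] have "((\<lambda>s. u s y) has_vector_derivative (\<Sum>b\<in>Basis. H (0, b) (1, 0) *\<^sub>R b)) (at t)"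
      unfolding has_vector_derivative_def .
    then show ?thesis by (rule vector_derivative_at)
  qed
  moreover have "frechet_derivative (u t) (at y) (u t y) =
      (\<Sum>b\<in>Basis. (\<Sum>a\<in>Basis. D (0, a) (t, y) * H (0, b) (0, a)) *\<^sub>R b)"
  proof -
    have eq: "G (t, z) = u t z" if "z \<in> V" for z
      using that ut[of z] grad_F[of t z] by (simp add: V_def)
    have "(u t has_derivative (\<lambda>v. \<Sum>b\<in>Basis. H (0, b) (0, v) *\<^sub>R b)) (at y)"
      by (rule has_derivative_transform_within_open[OF has_derivative_slice(1)[OF dG] V eq])
    from fun_cong[OF frechet_derivative_at[OF this], symmetric]
    have "frechet_derivative (u t) (at y) (u t y) = (\<Sum>b\<in>Basis. H (0, b) (0, u t y) *\<^sub>R b)" .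
    moreover have "(0, u t y) = (\<Sum>a\<in>Basis. D (0, a) (t, y) *\<^sub>R (0::real, a))"
      using ut[OF \<open>y \<in> W\<close>] grad_F[OF ty] by (simp add: G_def prod_eq_iff fst_sum snd_sum)
    moreover have "H v (\<Sum>a\<in>Basis. D (0, a) (t, y) *\<^sub>R (0, a)) = (\<Sum>a\<in>Basis. D (0, a) (t, y) * H v (0, a))" for v
      by (simp only: linear_sum[OF lin] linear_cmul[OF lin] real_scaleR_def)
    ultimately show ?thesis by (simp only:)
  qed
  moreover have "grad p y = (\<Sum>b\<in>Basis. (- H (1, 0) (0, b) -
      (\<Sum>a\<in>Basis. D (0, a) (t, y) * H (0, a) (0, b))) *\<^sub>R b)"
  proof -
    have p_eq: "c - D (1, 0) (t, z) - 1/2 * (\<Sum>a\<in>Basis. (D (0, a) (t, z))\<^sup>2) = p z" if "z \<in> V" for z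
    proof -
      have "(norm (G (t, z)))\<^sup>2 = (\<Sum>a\<in>Basis. (G (t, z) \<bullet> a)\<^sup>2)"
        unfolding power2_norm_eq_inner by (subst euclidean_inner) (simp add: power2_eq_square)
      also have "\<dots> = (\<Sum>a\<in>Basis. (D (0, a) (t, z))\<^sup>2)"
        by (simp add: G_def)
      finally show ?thesis
        using p[of z] that grad_F[of t z] dt_F[of z] by (simp add: V_def)
    qed
    have dD1: "((\<lambda>z. D v (t, z)) has_derivative (\<lambda>w. H v (0, w))) (at y)" for v
      by (rule has_derivative_slice(1)[OF dD])
    have "((\<lambda>z. c - D (1, 0) (t, z) - 1/2 * (\<Sum>a\<in>Basis. (D (0, a) (t, z))\<^sup>2)) has_derivative
        (\<lambda>w. - H (1, 0) (0, w) - (\<Sum>a\<in>Basis. D (0, a) (t, y) * H (0, a) (0, w)))) (at y)"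
      by (auto intro!: derivative_eq_intros dD1 simp: fun_eq_iff sum_distrib_left mult_ac)
    then have "(p has_derivative
        (\<lambda>w. - H (1, 0) (0, w) - (\<Sum>a\<in>Basis. D (0, a) (t, y) * H (0, a) (0, w)))) (at y)"
      by (rule has_derivative_transform_within_open[OF _ V p_eq])
    then show ?thesis by (rule GDERIV_grad(2))
  qed
  \<comment> \<open>In each coordinate the symmetry of \<open>H\<close> cancels the mixed time-space
    term against its counterpart in the pressure gradient, and the convective sum against the
    derivative of the kinetic energy.\<close>
  ultimately show ?thesis
    by (simp add: sym[of "(1, 0)"] sym[of "(0, _)" "(0, _)"] flip: sum.distrib scaleR_add_left)
qed

lemma isCont_grad:
  fixes f :: "'a::euclidean_space \<Rightarrow> real"
  assumes "open S" "Ck_on 2 S f" "x \<in> S"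
  shows "isCont (grad f) x"
proof -
  note df = Ck_on_2_has_derivative[OF assms(2)]
  have "continuous_on S (\<lambda>y. frechet_derivative f (at y) b)" for b
    using df(2) has_derivative_continuous by (intro continuous_at_imp_continuous_on) blast
  then have "continuous_on S (\<lambda>y. \<Sum>b\<in>Basis. frechet_derivative f (at y) b *\<^sub>R b)"
    by (intro continuous_intros)
  moreover have "(\<Sum>b\<in>Basis. frechet_derivative f (at y) b *\<^sub>R b) = grad f y" if "y \<in> S" for y
    using GDERIV_grad(2)[OF df(1)[OF that]] by simp
  ultimately have "continuous_on S (grad f)"
    by (simp only: cong: continuous_on_cong)
  then show ?thesis using assms continuous_on_eq_continuous_at by blast
qed

section \<open>The two boundary conditions at a point\<close>

text \<open>The squared bracket collapses to \<open>a * J / r\<close>, because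
  \<open>r * (a * r - b * g) + (a * g + b * r) * g\<close> is
  \<open>a * (r\<^sup>2 + g\<^sup>2)\<close>. Given the kinematic equation, the quadratic terms
  become \<open>ht * a - 1/2 * (a\<^sup>2 + b\<^sup>2)\<close>, and the Bernoulli identity leaves
  just \<open>p = \<sigma> * \<kappa>\<close>. The 1 subtracted from the curvature is the Bernoulli
  constant \<sigma>.\<close>

lemma boundary_equations_algebra:
  fixes a b g r J :: real
  assumes "r > 0" and J: "J = sqrt (r\<^sup>2 + g\<^sup>2)"
    and \<psi>\<theta>: "\<psi>\<theta> = a * g + b * r" and \<psi>t: "\<psi>t = dt + ht * a"
    and bernoulli: "dt + 1/2 * (a\<^sup>2 + b\<^sup>2) + p = \<sigma>"
    and N: "N = (a * r - b * g) / J"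
  shows "p = \<sigma> * \<kappa> \<and> ht * r / J = N \<longleftrightarrow>
    ht = J / r * N \<and> \<psi>t = 1/2 * (N + \<psi>\<theta> * g / (r * J))\<^sup>2 - \<psi>\<theta>\<^sup>2 / (2 * r\<^sup>2) - \<sigma> * (\<kappa> - 1)"
proof -
  have "J > 0" using \<open>r > 0\<close> by (simp add: J add_pos_nonneg)
  have Jsq: "J\<^sup>2 = r\<^sup>2 + g\<^sup>2" by (simp add: J)
  have "ht * r / J = N \<longleftrightarrow> ht = J / r * N"
    using \<open>r > 0\<close> \<open>J > 0\<close> by (auto simp: field_simps)
  moreover have "p = \<sigma> * \<kappa> \<longleftrightarrow>
      \<psi>t = 1/2 * (N + \<psi>\<theta> * g / (r * J))\<^sup>2 - \<psi>\<theta>\<^sup>2 / (2 * r\<^sup>2) - \<sigma> * (\<kappa> - 1)"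
    if ht: "ht = J / r * N"
  proof -
    have "N + \<psi>\<theta> * g / (r * J) = a * (r\<^sup>2 + g\<^sup>2) / (r * J)"
      using \<open>r > 0\<close> \<open>J > 0\<close> by (simp add: N \<psi>\<theta> field_simps power2_eq_square)
    also have "\<dots> = a * J / r"
      using \<open>r > 0\<close> \<open>J > 0\<close> unfolding Jsq[symmetric] by (simp add: power2_eq_square)
    finally have sq: "1/2 * (N + \<psi>\<theta> * g / (r * J))\<^sup>2 - \<psi>\<theta>\<^sup>2 / (2 * r\<^sup>2) =
        (a\<^sup>2 * (r\<^sup>2 + g\<^sup>2) - (a * g + b * r)\<^sup>2) / (2 * r\<^sup>2)"
      by (simp add: power_divide power_mult_distrib Jsq \<psi>\<theta> diff_divide_distrib)
    have hta: "ht * a = a * (a * r - b * g) / r"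
      using \<open>r > 0\<close> \<open>J > 0\<close> by (simp add: ht N)
    have "1/2 * (N + \<psi>\<theta> * g / (r * J))\<^sup>2 - \<psi>\<theta>\<^sup>2 / (2 * r\<^sup>2) = ht * a - 1/2 * (a\<^sup>2 + b\<^sup>2)"
    proof -
      have "(a\<^sup>2 * (r\<^sup>2 + g\<^sup>2) - (a * g + b * r)\<^sup>2) / (2 * r\<^sup>2) =
          a * (a * r - b * g) / r - 1/2 * (a\<^sup>2 + b\<^sup>2)"
        using \<open>r > 0\<close> by (simp add: field_simps power2_eq_square)
      then show ?thesis unfolding sq hta .
    qed
    then show ?thesis using bernoulli by (auto simp: \<psi>t algebra_simps)
  qed
  ultimately show ?thesis by blast
qed

text \<open>This supplies the inputs of the algebra. The derivative \<open>D\<close> of the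
  potential in space-time is composed with two curves: the boundary curve at fixed time, and the
  path of the boundary point with fixed \<open>x\<close>.\<close>

lemma boundary_conditions_iff:
  fixes h \<psi> \<Phi> :: "real \<Rightarrow> real^2 \<Rightarrow> real"
  assumes "open I" "t \<in> I" "star_shape (h t)" "x \<in> S1"
    and h: "\<And>\<theta>. (\<lambda>(t, \<theta>). h t (circ \<theta>)) differentiable (at (t, \<theta>))"
    and "open U" and U: "(t, bdry_param (h t) x) \<in> U" and C2: "Ck_on 2 U (\<lambda>(t, y). \<Phi> t y)"
    and datum: "\<And>s z. s \<in> I \<Longrightarrow> z \<in> S1 \<Longrightarrow> \<psi> s z = \<Phi> s (bdry_param (h s) z)"
    and dirichlet: "dirichlet_solution (h t) (\<psi> t) (\<Phi> t)"
    and bernoulli: "deriv (\<lambda>s. \<Phi> s (bdry_param (h t) x)) t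
      + 1/2 * (norm (grad (\<Phi> t) (bdry_param (h t) x)))\<^sup>2 + p = \<sigma>"
  shows "p = \<sigma> * \<kappa> \<and> normal_velocity h t x =
      grad (\<Phi> t) (bdry_param (h t) x) \<bullet> outward_unit_normal (star_domain (h t)) (bdry_param (h t) x) \<longleftrightarrow>
    deriv (\<lambda>s. h s x) t =
      sqrt ((1 + h t x)^2 + (norm (tangential_grad (h t) x))^2) / (1 + h t x)
        * dirichlet_neumann (h t) (\<psi> t) x \<and>
    deriv (\<lambda>s. \<psi> s x) t =
      1/2 * (dirichlet_neumann (h t) (\<psi> t) x
             + tangential_grad (\<psi> t) x \<bullet> tangential_grad (h t) x
               / ((1 + h t x) * sqrt ((1 + h t x)^2 + (norm (tangential_grad (h t) x))^2)))^2
      - (norm (tangential_grad (\<psi> t) x))^2 / (2 * (1 + h t x)^2)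
      - \<sigma> * (\<kappa> - 1)"
proof -
  interpret star_shape "h t" by fact
  obtain \<theta> where x: "x = circ \<theta>" using \<open>x \<in> S1\<close> S1_circ by blast
  let ?F = "\<lambda>(t, y). \<Phi> t y" and ?\<tau> = "rot90 x"
  let ?y = "bdry_param (h t) x" and ?r = "1 + h t x"
  let ?\<nu> = "outward_unit_normal (star_domain (h t)) ?y"
  have xx: "x \<bullet> x = 1" using \<open>x \<in> S1\<close> by (simp add: norm_eq_1)
  have r: "?r > 0" using gt[OF \<open>x \<in> S1\<close>] by simp
  obtain K where K: "((\<lambda>(t, \<theta>). h t (circ \<theta>)) has_derivative K) (at (t, \<theta>))"
    using h unfolding differentiable_def by blast
  obtain g where g: "((\<lambda>\<theta>. h t (circ \<theta>)) has_real_derivative g) (at \<theta>)"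
    using has_derivative_slice(1)[OF K] by (auto elim: has_real_derivative)
  obtain ht where ht: "((\<lambda>s. h s x) has_real_derivative ht) (at t)"
    using has_derivative_slice(2)[OF K] unfolding x by (auto elim: has_real_derivative)
  define D where "D = frechet_derivative ?F (at (t, ?y))"
  have D: "(?F has_derivative D) (at (t, ?y))"
    unfolding D_def by (rule Ck_on_2_has_derivative(1)[OF C2 U])
  define G where "G = grad (\<Phi> t) ?y"
  have G: "(\<Phi> t has_derivative (\<lambda>v. D (0, v))) (at ?y)"
    using has_derivative_slice(1)[OF D] by simp
  then have DG: "D (0, v) = G \<bullet> v" for v
    using grad_inner[OF G] by (simp add: G_def)
  define dt where "dt = D (1, 0)"
  have Dlin: "D (s, v) = s * dt + G \<bullet> v" for s v
  proof -
    have "D (s, v) = D (s *\<^sub>R (1, 0) + (0, v))" by simp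
    also have "\<dots> = s *\<^sub>R D (1, 0) + D (0, v)"
      using has_derivative_linear[OF D] by (simp only: linear_add linear_cmul)
    finally show ?thesis by (simp add: dt_def DG)
  qed
  have dt: "deriv (\<lambda>s. \<Phi> s ?y) t = dt"
    using has_derivative_slice(2)[OF D]
    by (intro DERIV_imp_deriv) (simp add: Dlin has_field_derivative_def mult_commute_abs)
  define a where "a = G \<bullet> x"
  define b where "b = G \<bullet> ?\<tau>"
  have tg_h: "tangential_grad (h t) x = g *\<^sub>R ?\<tau>"
    unfolding x by (rule tangential_grad_circ[OF g])
  have tg_\<psi>: "tangential_grad (\<psi> t) x = (a * g + b * ?r) *\<^sub>R ?\<tau>"
    unfolding x
  proof (rule tangential_grad_circ)
    have "((\<lambda>s. bdry_param (h t) (circ s)) has_vector_derivative ?r *\<^sub>R ?\<tau> + g *\<^sub>R x) (at \<theta>)"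
      unfolding bdry_param_def x
      by (auto intro!: derivative_eq_intros g circ_has_vector_derivative)
    then have "((\<lambda>s. bdry_param (h t) (circ s)) has_derivative (\<lambda>s. s *\<^sub>R (?r *\<^sub>R ?\<tau> + g *\<^sub>R x))) (at \<theta>)"
      by (simp only: has_vector_derivative_def)
    from has_derivative_compose[OF this, of "\<Phi> t"] G
    have "((\<lambda>s. \<Phi> t (bdry_param (h t) (circ s))) has_derivative
        (\<lambda>s. D (0, s *\<^sub>R (?r *\<^sub>R ?\<tau> + g *\<^sub>R x)))) (at \<theta>)"
      by (simp only: x)
    moreover have "D (0, s *\<^sub>R (?r *\<^sub>R ?\<tau> + g *\<^sub>R x)) = (a * g + b * ?r) * s" for s
      by (simp add: DG a_def b_def inner_add_right algebra_simps)
    moreover have "\<Phi> t (bdry_param (h t) (circ s)) = \<psi> t (circ s)" for s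
      using datum \<open>t \<in> I\<close> by simp
    ultimately show "((\<lambda>\<theta>. \<psi> t (circ \<theta>)) has_real_derivative
        a * g + b * (1 + h t (circ \<theta>))) (at \<theta>)"
      by (simp only: has_field_derivative_def x)
  qed
  have \<psi>t: "deriv (\<lambda>s. \<psi> s x) t = dt + ht * a"
  proof (rule DERIV_imp_deriv)
    have "((\<lambda>s. (s, bdry_param (h s) x)) has_derivative (\<lambda>s. (s, (ht * s) *\<^sub>R x))) (at t)"
      using ht unfolding bdry_param_def has_field_derivative_def
      by (auto intro!: derivative_eq_intros)
    from has_derivative_compose[OF this D]
    have "((\<lambda>s. \<Phi> s (bdry_param (h s) x)) has_derivative (\<lambda>s. D (s, (ht * s) *\<^sub>R x))) (at t)"
      by simp
    moreover have "(\<lambda>s. D (s, (ht * s) *\<^sub>R x)) = (*) (dt + ht * a)"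
      by (simp add: fun_eq_iff Dlin a_def algebra_simps)
    ultimately have "((\<lambda>s. \<Phi> s (bdry_param (h s) x)) has_real_derivative dt + ht * a) (at t)"
      by (simp only: has_field_derivative_def)
    \<comment> \<open>The datum equals the trace of the potential only for times in
      \<open>I\<close>; openness of \<open>I\<close> transfers the derivative.\<close>
    then show "((\<lambda>s. \<psi> s x) has_real_derivative dt + ht * a) (at t)"
      by (rule has_field_derivative_transform_within_open[OF _ \<open>open I\<close> \<open>t \<in> I\<close>])
        (use datum \<open>x \<in> S1\<close> in auto)
  qed
  define J where "J = sqrt (?r\<^sup>2 + g\<^sup>2)"
  have \<nu>: "?\<nu> = (?r *\<^sub>R x - g *\<^sub>R ?\<tau>) /\<^sub>R J"
    unfolding x J_def by (rule outward_unit_normal_star_domain[OF g])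
  have G\<nu>: "G \<bullet> ?\<nu> = (a * ?r - b * g) / J"
    unfolding \<nu> by (simp add: inner_diff_right a_def b_def divide_inverse mult_ac)
  have V: "normal_velocity h t x = ht * ?r / J"
  proof -
    have "((\<lambda>s. bdry_param (h s) x) has_vector_derivative ht *\<^sub>R x) (at t)"
      unfolding bdry_param_def by (auto intro!: derivative_eq_intros ht)
    then have "normal_velocity h t x = (ht *\<^sub>R x) \<bullet> ?\<nu>"
      by (simp add: normal_velocity_def vector_derivative_at)
    also have "\<dots> = ht * ?r / J"
      unfolding \<nu> by (simp add: inner_diff_right xx divide_inverse)
    finally show ?thesis .
  qed
  have N: "dirichlet_neumann (h t) (\<psi> t) x = G \<bullet> ?\<nu>"
    unfolding G_def
  proof (rule dirichlet_neumann_eq[OF assms(3) dirichlet \<open>x \<in> S1\<close>])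
    \<comment> \<open>The slice of \<open>U\<close> at time \<open>t\<close> is an open set around
      the boundary point, so continuity holds there from both sides.\<close>
    show "isCont (grad (\<Phi> t)) ?y"
      by (rule isCont_grad[OF open_slice[OF \<open>open U\<close>, of t]])
        (use Ck_on_slice[OF \<open>open U\<close> C2, of t] U in auto)
  qed
  have norm_G: "(norm G)\<^sup>2 = a\<^sup>2 + b\<^sup>2"
  proof -
    have "G = a *\<^sub>R x + b *\<^sub>R ?\<tau>"
      unfolding a_def b_def by (rule rot90_decomp) (use \<open>x \<in> S1\<close> in simp)
    then show ?thesis
      unfolding power2_norm_eq_inner
      by (simp add: inner_add_left inner_add_right xx power2_eq_square)
  qed
  have norms: "(norm (c *\<^sub>R ?\<tau>))\<^sup>2 = c\<^sup>2" "c *\<^sub>R ?\<tau> \<bullet> d *\<^sub>R ?\<tau> = c * d" for c d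
    using \<open>x \<in> S1\<close> by (simp_all add: xx)
  show ?thesis
    unfolding tg_h tg_\<psi> norms \<psi>t DERIV_imp_deriv[OF ht] V N G_def[symmetric] J_def[symmetric]
    by (rule boundary_equations_algebra[OF r J_def refl refl _ G\<nu>])
      (use bernoulli in \<open>simp add: dt norm_G flip: G_def\<close>)
qed

text \<open>The Dirichlet conjunct on the right carries the incompressibility of \<open>u\<close>:
  \<open>boundary_system\<close> mentions only the datum \<psi>, and \<open>boundary_datum\<close>
  fixes \<Phi> only on the boundary.\<close>

theorem theorem3p1:
  fixes \<sigma>\<^sub>0 :: real and I :: "real set"
    and h \<psi> \<Phi> p :: "real \<Rightarrow> real^2 \<Rightarrow> real"
    and u :: "real \<Rightarrow> real^2 \<Rightarrow> real^2"
    and U :: "(real \<times> (real^2)) set"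
  assumes "open I"
    and h_gt: "\<And>t x. t \<in> I \<Longrightarrow> x \<in> S1 \<Longrightarrow> h t x > -1"
    and h_smooth: "Ck_on 2 (I \<times> UNIV) (\<lambda>(t, \<theta>). h t (circ \<theta>))"
    and U: "open U" "\<And>t y. t \<in> I \<Longrightarrow> y \<in> closure (star_domain (h t)) \<Longrightarrow> (t, y) \<in> U"
    and \<Phi>_smooth: "Ck_on 2 U (\<lambda>(t, y). \<Phi> t y)"
    and potential: "\<And>t y. t \<in> I \<Longrightarrow> y \<in> closure (star_domain (h t)) \<Longrightarrow> u t y = grad (\<Phi> t) y"
    and boundary_datum: "\<And>t x. t \<in> I \<Longrightarrow> x \<in> S1 \<Longrightarrow> \<psi> t x = \<Phi> t (bdry_param (h t) x)"
    and bernoulli: "\<And>t y. t \<in> I \<Longrightarrow> y \<in> closure (star_domain (h t)) \<Longrightarrow>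
        deriv (\<lambda>s. \<Phi> s y) t + 1/2 * (norm (grad (\<Phi> t) y))^2 + p t y = \<sigma>\<^sub>0"
  shows "free_boundary_problem \<sigma>\<^sub>0 I h u p \<longleftrightarrow>
         (\<forall>t\<in>I. dirichlet_solution (h t) (\<psi> t) (\<Phi> t)) \<and> boundary_system \<sigma>\<^sub>0 I h \<psi>"
proof -
  let ?F = "\<lambda>(t, y). \<Phi> t y"
  have h_diff: "(\<lambda>(t, \<theta>). h t (circ \<theta>)) differentiable (at (t, \<theta>))" if "t \<in> I" for t \<theta>
    using h_smooth that by (simp add: numeral_2_eq_2)
  have star: "star_shape (h t)" if "t \<in> I" for t
  proof
    show "h t x > -1" if "x \<in> S1" for x using h_gt \<open>t \<in> I\<close> that .
    have "isCont (\<lambda>\<theta>. h t (circ \<theta>)) \<theta>" for \<theta>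
    proof -
      obtain K where "((\<lambda>(t, \<theta>). h t (circ \<theta>)) has_derivative K) (at (t, \<theta>))"
        using h_diff[OF \<open>t \<in> I\<close>] unfolding differentiable_def by blast
      from has_derivative_slice(1)[OF this] show ?thesis
        using has_derivative_continuous by force
    qed
    then show "continuous_on S1 (h t)"
      by (intro continuous_on_S1_if_circ continuous_at_imp_continuous_on) blast
  qed
  have C2: "Ck_on 2 {y. (t, y) \<in> U} (\<Phi> t)" for t
    using Ck_on_slice[OF U(1) \<Phi>_smooth, of t] by simp
  \<comment> \<open>For fixed \<open>y\<close> other than 0, membership in the domain at time
    \<open>s\<close> is the strict inequality \<open>norm y < 1 + h s (sgn y)\<close>, which
    persists by continuity in \<open>s\<close>; the origin always belongs.\<close>
  have stays: "\<forall>\<^sub>F s in nhds t. s \<in> I \<and> y \<in> star_domain (h s)" if "t \<in> I" "y \<in> star_domain (h t)" for t y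
  proof -
    have "\<forall>\<^sub>F s in nhds t. s \<in> I" using \<open>open I\<close> \<open>t \<in> I\<close> by (rule eventually_nhds_in_open)
    moreover have "\<forall>\<^sub>F s in nhds t. y = 0 \<or> norm y < 1 + h s (sgn y)"
    proof (cases "y = 0")
      case False
      then obtain \<theta> where \<theta>: "sgn y = circ \<theta>" using S1_circ by (metis imageE mem_sphere_0 norm_sgn)
      obtain K where "((\<lambda>(t, \<theta>). h t (circ \<theta>)) has_derivative K) (at (t, \<theta>))"
        using h_diff[OF \<open>t \<in> I\<close>] unfolding differentiable_def by blast
      from has_derivative_slice(2)[OF this] have "isCont (\<lambda>s. h s (sgn y)) t"
        unfolding \<theta> using has_derivative_continuous by force
      then have "((\<lambda>s. 1 + h s (sgn y)) \<longlongrightarrow> 1 + h t (sgn y)) (nhds t)"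
        using tendsto_at_iff_tendsto_nhds[of "\<lambda>s. h s (sgn y)" t]
        by (intro tendsto_intros) (simp add: isCont_def)
      moreover have "norm y < 1 + h t (sgn y)"
        using that star_shape.star_domain_iff[OF star[OF \<open>t \<in> I\<close>]] False by blast
      ultimately show ?thesis by (auto dest: order_tendstoD(1) elim: eventually_mono)
    qed simp
    ultimately show ?thesis
      by eventually_elim (use star_shape.star_domain_iff[OF star] in blast)
  qed
  have div: "(\<forall>y\<in>star_domain (h t). divergence (u t) y = 0) \<longleftrightarrow> dirichlet_solution (h t) (\<psi> t) (\<Phi> t)"
    if t: "t \<in> I" for t
  proof -
    have "divergence (u t) y = laplacian (\<Phi> t) y" if "y \<in> star_domain (h t)" for y
      unfolding laplacian_def
      by (rule divergence_cong[OF star_shape.open_star_domain[OF star[OF t]] that])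
        (use potential t closure_subset in blast)
    moreover have "Ck_on 2 (star_domain (h t)) (\<Phi> t)"
      by (rule Ck_on_subset[OF C2]) (use U(2) t closure_subset in blast)
    moreover have "continuous_on (closure (star_domain (h t))) (\<Phi> t)"
      by (rule continuous_on_subset[OF Ck_on_Suc_continuous[OF C2[unfolded numeral_2_eq_2]]])
        (use U(2) t in blast)
    ultimately show ?thesis
      using boundary_datum[OF t] unfolding dirichlet_solution_def by auto
  qed
  have euler: "vector_derivative (\<lambda>s. u s y) (at t) + frechet_derivative (u t) (at y) (u t y) + grad (p t) y = 0"
    if t: "t \<in> I" and y: "y \<in> star_domain (h t)" for t y
  proof (rule euler_if_bernoulli[OF U(1) \<Phi>_smooth, where W = "star_domain (h t)"])
    show "(t, y) \<in> U" using U(2)[OF t] y closure_subset by blast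
    show "\<forall>\<^sub>F s in nhds t. u s y = grad (\<lambda>z. ?F (s, z)) y"
      using stays[OF t y] by eventually_elim (use potential closure_subset in force)
    show "u t z = grad (\<lambda>z. ?F (t, z)) z" if "z \<in> star_domain (h t)" for z
      using potential[OF t, of z] that closure_subset by auto
    show "deriv (\<lambda>s. ?F (s, z)) t + 1/2 * (norm (grad (\<lambda>z. ?F (t, z)) z))\<^sup>2 + p t z = \<sigma>\<^sub>0"
      if "z \<in> star_domain (h t)" for z
      using bernoulli[OF t, of z] that closure_subset by auto
  qed (use star_shape.open_star_domain[OF star[OF t]] y in auto)
  have bdry: "(\<forall>y\<in>frontier (star_domain (h t)). p t y = \<sigma>\<^sub>0 * curvature (star_domain (h t)) y) \<and>
      (\<forall>x\<in>S1. normal_velocity h t x =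
        u t (bdry_param (h t) x) \<bullet> outward_unit_normal (star_domain (h t)) (bdry_param (h t) x)) \<longleftrightarrow>
      boundary_system \<sigma>\<^sub>0 {t} h \<psi>"
    if t: "t \<in> I" and sol: "dirichlet_solution (h t) (\<psi> t) (\<Phi> t)" for t
  proof -
    interpret star_shape "h t" by (rule star[OF t])
    have "p t (bdry_param (h t) x) = \<sigma>\<^sub>0 * bdry_curvature (h t) x \<and>
        normal_velocity h t x =
          u t (bdry_param (h t) x) \<bullet> outward_unit_normal (star_domain (h t)) (bdry_param (h t) x) \<longleftrightarrow>
        deriv (\<lambda>s. h s x) t =
          sqrt ((1 + h t x)^2 + (norm (tangential_grad (h t) x))^2) / (1 + h t x)
            * dirichlet_neumann (h t) (\<psi> t) x \<and>
        deriv (\<lambda>s. \<psi> s x) t =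
          1/2 * (dirichlet_neumann (h t) (\<psi> t) x
                 + tangential_grad (\<psi> t) x \<bullet> tangential_grad (h t) x
                   / ((1 + h t x) * sqrt ((1 + h t x)^2 + (norm (tangential_grad (h t) x))^2)))^2
          - (norm (tangential_grad (\<psi> t) x))^2 / (2 * (1 + h t x)^2)
          - \<sigma>\<^sub>0 * (bdry_curvature (h t) x - 1)" if x: "x \<in> S1" for x
      unfolding potential[OF t bdry_param_mem(2)[OF x]]
      by (rule boundary_conditions_iff[OF \<open>open I\<close> t star[OF t] x h_diff[OF t] U(1)
            U(2)[OF t bdry_param_mem(2)[OF x]] \<Phi>_smooth boundary_datum sol
            bernoulli[OF t bdry_param_mem(2)[OF x]]])
    then show ?thesis
      unfolding boundary_system_def frontier_star_domain bdry_curvature_def ball_simps by blast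
  qed
  have "boundary_system \<sigma>\<^sub>0 I h \<psi> \<longleftrightarrow> (\<forall>t\<in>I. boundary_system \<sigma>\<^sub>0 {t} h \<psi>)"
    by (simp add: boundary_system_def)
  \<comment> \<open>The equivalence \<open>bdry\<close> presupposes the Dirichlet problem: from the
    left it comes out of the divergence condition by \<open>div\<close>, from the right it is the
    first conjunct.\<close>
  then show ?thesis
    unfolding free_boundary_problem_def using div euler bdry by blast
qed

end
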